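(* The group $F\left(\frac32\right)$ is generated by the two elements $l$ and $r$ given by $$l(t)=\begin{cases}\frac{3t}{2}& t\in[0,\frac29]\\ t+\frac19& t\in[\frac29,\frac13]\\ \frac{2t}{3}+\frac29& t\in[\frac13,\frac23]\\ t& t\in[\frac23,1]\end{cases}\qquad r(t)=\begin{cases}t& t\in[0,\frac13]\\ \frac{3t}{2}-\frac16& t\in[\frac13,\frac59]\\ t+\frac19& t\in[\frac59,\frac23]\\ \frac{2t}{3}+\frac13& t\in[\frac23,1].\end{cases}$$
   Context: $F\left(\frac32\right)$ is the group of all orientation-preserving piecewise-linear homeomorphisms of $[0,1]$ with finitely many linear pieces, such that the slope of every piece is an integer power of $\frac32$ (i.e. $(3/2)^k$, $k\in\mathbb Z$), and the breakpoints (points where the slope changes) have coordinates in $\mathbb Z\left[\frac16\right]$ (rationals whose denominators have only $2$ and/or $3$ as prime factors). The group operation is composition, written $h=fg$ when $h(x)=g(f(x))$. *)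

theory Defs
  imports "HOL-Analysis.Analysis" "HOL-Algebra.Generated_Groups"
begin

definition Z_inv_6 :: "real set" where
  "Z_inv_6 = {of_int a / 6 ^ n | (a :: int) (n :: nat). True}"

text \<open>The linear pieces of \<^term>\<open>f\<close> are its restrictions to \<^term>\<open>{x i..x (Suc i)}\<close>, the slope there
  being \<^term>\<open>(3/2 :: real) powi (k i)\<close>. Adjacent pieces may have the same slope, so the subdivision
  points are constrained only where the slope really changes. A breakpoint is a point of the graph:
  both of its coordinates are required to be in \<^term>\<open>Z_inv_6\<close>.\<close>

definition PL_3_2 :: "(real \<Rightarrow> real) \<Rightarrow> bool" where
  "PL_3_2 f \<longleftrightarrow>
    (\<exists>(n :: nat) (x :: nat \<Rightarrow> real) (k :: nat \<Rightarrow> int).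
       x 0 = 0 \<and> x n = 1 \<and> (\<forall>i<n. x i < x (Suc i)) \<and>
       (\<forall>i<n. \<forall>t\<in>{x i..x (Suc i)}. f t = f (x i) + (3/2) powi (k i) * (t - x i)) \<and>
       (\<forall>i. Suc i < n \<and> k i \<noteq> k (Suc i) \<longrightarrow>
            x (Suc i) \<in> Z_inv_6 \<and> f (x (Suc i)) \<in> Z_inv_6))"

text \<open>Self-maps of \<^term>\<open>{0..1 :: real}\<close> are represented by functions that are \<^term>\<open>undefined\<close> outside
  the interval, so that equality of elements is equality on the interval. The product of
  \<^term>\<open>f\<close> and \<^term>\<open>g\<close> applies \<^term>\<open>f\<close> first.\<close>

definition F_3_2 :: "(real \<Rightarrow> real) monoid" where
  "F_3_2 =
    \<lparr> carrier = {f \<in> extensional {0..1}.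
        (\<exists>g. homeomorphism {0..1} {0..1} f g) \<and> strict_mono_on {0..1} f \<and> PL_3_2 f},
      mult = (\<lambda>f g. compose {0..1} g f),
      one = (\<lambda>t\<in>{0..1}. t) \<rparr>"

definition l_map :: "real \<Rightarrow> real" where
  "l_map = (\<lambda>t\<in>{0..1}.
     if t \<le> 2/9 then 3 * t / 2
     else if t \<le> 1/3 then t + 1/9
     else if t \<le> 2/3 then 2 * t / 3 + 2/9
     else t)"

definition r_map :: "real \<Rightarrow> real" where
  "r_map = (\<lambda>t\<in>{0..1}.
     if t \<le> 1/3 then t
     else if t \<le> 5/9 then 3 * t / 2 - 1/6
     else if t \<le> 2/3 then t + 1/9
     else 2 * t / 3 + 1/3)"

end

theory Submission
  imports Defs
begin

text \<open>The group is studied through a copy that acts on the half-line. The map \<open>telescope\<close> identifies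
  the half-line with the unit interval without its right end; it fixes everything up to \<open>7/9\<close> and
  turns the translation by \<open>1/9\<close> far out into the contraction by \<open>2/3\<close> towards the point 1. In this
  picture \<open>r\<close> is \<open>stretch (3/9) (1/9)\<close>, where \<open>stretch a v\<close> is the identity up to \<open>a\<close>, has slope
  \<open>3/2\<close> on an interval of length \<open>2 v\<close>, and translates by \<open>v\<close> afterwards; and \<open>l\<close> composed with \<open>r\<close>
  is \<open>stretch 0 (1/9)\<close>. The set \<open>lifted\<close> consists of the maps of the half-line that correspond to
  elements generated by \<open>l\<close> and \<open>r\<close>; it is closed under composition and inverses.

  Conjugation by \<open>stretch 0 (1/9)\<close> is the translation by \<open>1/9\<close> on maps that live beyond \<open>2/9\<close>.
  Hence \<open>lifted\<close> contains all \<open>stretch (n/9) (1/9)\<close> with \<open>n \<ge> 3\<close>, and, putting such maps one behind the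
  other, all \<open>stretch 0 (n/9)\<close>. The latter multiply arbitrarily long initial segments by \<open>3/2\<close>, so
  that among compactly supported maps \<open>lifted\<close> is invariant under scaling by \<open>3/2\<close>. Scaling and
  translation by \<open>1/9\<close> together yield translation by every element of the ring generated by \<open>3/2\<close>
  and \<open>2/3\<close>, which is \<open>Z_inv_6\<close>; this is \<open>far_shift_Z_inv_6\<close>.

  The basic compactly supported maps are \<open>exchange a b v\<close>, which stretches at \<open>a\<close> and undoes the
  stretching at \<open>b\<close>. The step from which finite generation springs is \<open>far_exchange_half\<close>: a stretch
  of width \<open>3/2 * v\<close> is one of width \<open>v\<close> and one of width \<open>v / 2\<close>, and the widths \<open>v\<close> and \<open>3/2 * v\<close> are
  equivalent by scaling, so exchanges of width \<open>v\<close> produce exchanges of width \<open>v / 2\<close>. Scaling again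
  one obtains all widths \<open>1 / (9 * 6 ^ m)\<close>.

  An element of the group that is the identity on \<open>{0..2/9}\<close> and on \<open>{7/9..1}\<close> is a word in stretches
  and shrinks of one such width at multiples of this width (\<open>head_word\<close>). The translation lengths
  in the word add up to 0, which allows to rewrite it as a product of exchanges
  (\<open>lattice_words_lifted\<close>); so it is generated by \<open>l\<close> and \<open>r\<close>. An arbitrary element becomes the
  identity near both ends after multiplication by powers of \<open>l\<close> and \<open>r\<close>, and conjugation by \<open>l\<close> and
  \<open>r\<close> then moves its support away from the ends.\<close>

section \<open>Fractions whose denominator is a power of 6\<close>

lemma Z_inv_6_of_int: "real_of_int i \<in> Z_inv_6"
  unfolding Z_inv_6_def by (auto intro!: exI[of _ i] exI[of _ "0::nat"])

lemma Z_inv_6_0 [simp]: "0 \<in> Z_inv_6" and Z_inv_6_1 [simp]: "1 \<in> Z_inv_6"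
  using Z_inv_6_of_int[of 0] Z_inv_6_of_int[of 1] by simp_all

lemma Z_inv_6_add:
  assumes "x \<in> Z_inv_6" "y \<in> Z_inv_6"
  shows "x + y \<in> Z_inv_6"
proof -
  obtain i m j n where "x = of_int i / 6 ^ m" "y = of_int j / 6 ^ n"
    using assms unfolding Z_inv_6_def by blast
  then have "x + y = of_int (i * 6 ^ n + j * 6 ^ m) / 6 ^ (m + n)"
    by (simp add: power_add add_divide_distrib)
  then show ?thesis
    unfolding Z_inv_6_def by blast
qed

lemma Z_inv_6_mult:
  assumes "x \<in> Z_inv_6" "y \<in> Z_inv_6"
  shows "x * y \<in> Z_inv_6"
proof -
  obtain i m j n where "x = of_int i / 6 ^ m" "y = of_int j / 6 ^ n"
    using assms unfolding Z_inv_6_def by blast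
  then have "x * y = of_int (i * j) / 6 ^ (m + n)"
    by (simp add: power_add)
  then show ?thesis
    unfolding Z_inv_6_def by blast
qed

lemma Z_inv_6_minus: "x \<in> Z_inv_6 \<Longrightarrow> - x \<in> Z_inv_6"
  using Z_inv_6_mult[OF Z_inv_6_of_int[of "- 1"]] by simp

lemma Z_inv_6_diff: "x \<in> Z_inv_6 \<Longrightarrow> y \<in> Z_inv_6 \<Longrightarrow> x - y \<in> Z_inv_6"
  using Z_inv_6_add[OF _ Z_inv_6_minus] by fastforce

lemma Z_inv_6_frac: "real_of_int i / 6 ^ n \<in> Z_inv_6"
  unfolding Z_inv_6_def by blast

lemma Z_inv_6_half: "1 / 2 \<in> Z_inv_6" and Z_inv_6_ninth: "1 / 9 \<in> Z_inv_6"
  using Z_inv_6_frac[of 3 1] Z_inv_6_frac[of 4 2] by simp_all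

lemma Z_inv_6_powi: "(3 / 2 :: real) powi k \<in> Z_inv_6"
proof -
  have "(3 / 2 :: real) ^ n \<in> Z_inv_6" "(2 / 3 :: real) ^ n \<in> Z_inv_6" for n
    using Z_inv_6_mult[OF Z_inv_6_frac[of 9 1]] Z_inv_6_mult[OF Z_inv_6_frac[of 4 1]]
    by (induction n) simp_all
  then show ?thesis
    by (simp add: power_int_def inverse_eq_divide power_divide)
qed

lemma Z_inv_6_eventually_lattice:
  assumes "x \<in> Z_inv_6"
  shows "\<forall>\<^sub>F m in sequentially. \<exists>j. x = real_of_int j * (1 / (9 * 6 ^ m))"
proof -
  obtain i n where x: "x = of_int i / 6 ^ n"
    using assms unfolding Z_inv_6_def by blast
  have "\<exists>j. x = real_of_int j * (1 / (9 * 6 ^ m))" if "n \<le> m" for m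
    using that
    by (intro exI[of _ "9 * i * 6 ^ (m - n)"]) (simp add: x field_simps flip: power_add)
  then show ?thesis
    unfolding eventually_sequentially by blast
qed

section \<open>Piecewise linearity relative to a finite set of breakpoints\<close>

definition affine_piece :: "(real \<Rightarrow> real) \<Rightarrow> real \<Rightarrow> real \<Rightarrow> int \<Rightarrow> bool" where
  "affine_piece f p q k \<longleftrightarrow> (\<forall>t\<in>{p..q}. f t = f p + (3/2) powi k * (t - p))"

lemma affine_pieceI:
  "(\<And>t. p \<le> t \<Longrightarrow> t \<le> q \<Longrightarrow> f t = f p + (3/2) powi k * (t - p)) \<Longrightarrow> affine_piece f p q k"
  unfolding affine_piece_def by (meson atLeastAtMost_iff)

lemma affine_pieceD:
  "affine_piece f p q k \<Longrightarrow> p \<le> t \<Longrightarrow> t \<le> q \<Longrightarrow> f t = f p + (3/2) powi k * (t - p)"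
  unfolding affine_piece_def by (meson atLeastAtMost_iff)

definition subdivision :: "(real \<Rightarrow> real) \<Rightarrow> nat \<Rightarrow> (nat \<Rightarrow> real) \<Rightarrow> (nat \<Rightarrow> int) \<Rightarrow> bool" where
  "subdivision f n x k \<longleftrightarrow> x 0 = 0 \<and> x n = 1 \<and> (\<forall>i<n. x i < x (Suc i)) \<and>
     (\<forall>i<n. affine_piece f (x i) (x (Suc i)) (k i)) \<and>
     (\<forall>i. Suc i < n \<and> k i \<noteq> k (Suc i) \<longrightarrow> x (Suc i) \<in> Z_inv_6 \<and> f (x (Suc i)) \<in> Z_inv_6)"

lemma PL_3_2_iff: "PL_3_2 f \<longleftrightarrow> (\<exists>n x k. subdivision f n x k)"
  unfolding PL_3_2_def subdivision_def affine_piece_def by (rule refl)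

text \<open>A description of piecewise linearity by a set that contains all breakpoints, instead of an
  enumeration of pieces: common refinements, images and preimages of subdivisions become unions,
  images and preimages of sets.\<close>

definition breaks_in :: "(real \<Rightarrow> real) \<Rightarrow> real set \<Rightarrow> bool" where
  "breaks_in f S \<longleftrightarrow> finite S \<and> S \<subseteq> Z_inv_6 \<and>
     (\<forall>p q. 0 \<le> p \<and> p < q \<and> q \<le> 1 \<and> {p<..<q} \<inter> S = {} \<longrightarrow> (\<exists>k. affine_piece f p q k))"

text \<open>Only the points of the subdivision at which the slope changes are kept; the others need not lie
  in \<^term>\<open>Z_inv_6\<close>.\<close>

lemma PL_3_2_imp_breaks_in:
  assumes "PL_3_2 f"
  shows "\<exists>S. breaks_in f S"
proof -
  obtain n x k where "subdivision f n x k"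
    using assms[unfolded PL_3_2_iff] by blast
  note * = this[unfolded subdivision_def]
  have x0: "x 0 = 0" and xn: "x n = 1"
    and inc: "\<And>i. i < n \<Longrightarrow> x i < x (Suc i)"
    and aff: "\<And>i. i < n \<Longrightarrow> affine_piece f (x i) (x (Suc i)) (k i)"
    and brk: "\<And>i. Suc i < n \<Longrightarrow> k i \<noteq> k (Suc i) \<Longrightarrow> x (Suc i) \<in> Z_inv_6"
    using * by simp_all
  define S where "S = (\<lambda>i. x (Suc i)) ` {i. Suc i < n \<and> k i \<noteq> k (Suc i)}"
  have "finite {i. Suc i < n \<and> k i \<noteq> k (Suc i)}"
    by (rule finite_subset[of _ "{..<n}"]) auto
  then have finS: "finite S"
    unfolding S_def by blast
  have SA: "S \<subseteq> Z_inv_6"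
    using brk by (auto simp: S_def)
  have mono: "x i \<le> x j" if "i \<le> j" "j \<le> n" for i j
    using that
  proof (induction j rule: dec_induct)
    case (step j)
    then show ?case using inc[of j] by simp
  qed simp
  have locate: "\<exists>i<n. x i \<le> t \<and> t < x (Suc i)" if "0 \<le> t" "t < 1" for t
  proof -
    define i where "i = (LEAST i. t < x i)"
    have "t < x n" using that xn by simp
    then have i: "t < x i" "i \<le> n" and least: "\<And>j. t < x j \<Longrightarrow> i \<le> j"
      unfolding i_def by (auto intro: LeastI Least_le)
    have "i \<noteq> 0" using i(1) x0 that by (intro notI) simp
    then obtain i' where i': "i = Suc i'" using not0_implies_Suc by blast
    have "x i' \<le> t" using least[of i'] i' by (force simp: not_less[symmetric])
    then show ?thesis using i i' by (intro exI[of _ i']) auto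
  qed
  have "\<exists>k. affine_piece f p q k"
    if pq: "0 \<le> p" "p < q" "q \<le> 1" and miss: "{p<..<q} \<inter> S = {}" for p q
  proof -
    have "p < 1" using pq by simp
    obtain i where i: "i < n" "x i \<le> p" "p < x (Suc i)"
      using locate[OF pq(1) \<open>p < 1\<close>] by blast
    \<comment> \<open>Starting at \<open>i\<close>, the slope stays the same as long as the left ends lie below \<open>q\<close>.\<close>
    have run: "(j < n \<and> x j < q \<longrightarrow> k j = k i) \<and>
        (\<forall>t\<in>{x i..x j}. t \<le> q \<longrightarrow> f t = f (x i) + (3/2) powi k i * (t - x i))"
      if "i \<le> j" "j \<le> n" for j
      using that
    proof (induction j rule: dec_induct)
      case base
      then show ?case by auto
    next
      case (step j)
      have jn: "j < n" using step.prems by simp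
      have IH: "x j < q \<Longrightarrow> k j = k i"
        "\<And>t. t \<in> {x i..x j} \<Longrightarrow> t \<le> q \<Longrightarrow> f t = f (x i) + (3/2) powi k i * (t - x i)"
        using step.IH jn less_imp_le by blast+
      have "f t = f (x i) + (3/2) powi k i * (t - x i)"
        if t: "t \<in> {x i..x (Suc j)}" "t \<le> q" for t
      proof (cases "t \<le> x j")
        case True
        then show ?thesis by (intro IH(2)) (use t in auto)
      next
        case False
        then have kj: "k j = k i" using IH(1) t by auto
        have "f t = f (x j) + (3/2) powi k j * (t - x j)"
          by (rule affine_pieceD[OF aff[OF jn]]) (use t False in auto)
        moreover have "f (x j) = f (x i) + (3/2) powi k i * (x j - x i)"
          by (rule IH(2)) (use mono[OF step.hyps(1)] jn False t in auto)
        ultimately show ?thesis unfolding kj by (simp add: algebra_simps)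
      qed
      moreover have "k (Suc j) = k i" if j: "Suc j < n" "x (Suc j) < q"
      proof -
        have "p < x (Suc j)" using i mono[of "Suc i" "Suc j"] step.hyps jn by auto
        then have "x (Suc j) \<notin> S" using miss j by auto
        then have "k j = k (Suc j)" using j unfolding S_def by blast
        moreover have "k j = k i" using IH(1) inc[of j] j by auto
        ultimately show ?thesis by simp
      qed
      ultimately show ?case by blast
    qed
    have *: "f t = f (x i) + (3/2) powi k i * (t - x i)" if "p \<le> t" "t \<le> q" for t
    proof -
      have "\<forall>t\<in>{x i..x n}. t \<le> q \<longrightarrow> f t = f (x i) + (3/2) powi k i * (t - x i)"
        using run[of n] i(1) by (meson less_imp_le order_refl)
      moreover have "t \<in> {x i..x n}" using i xn that pq by auto
      ultimately show ?thesis using that by blast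
    qed
    have "affine_piece f p q (k i)"
    proof (rule affine_pieceI)
      fix t assume "p \<le> t" "t \<le> q"
      then show "f t = f p + (3/2) powi k i * (t - p)"
        using *[of t] *[of p] pq by (simp add: algebra_simps)
    qed
    then show ?thesis by blast
  qed
  then have "breaks_in f S"
    using finS SA unfolding breaks_in_def by simp
  then show ?thesis by blast
qed

text \<open>The last break before \<open>t\<close>, or the left end; the recursion along the pieces descends to it.\<close>

lemma breaks_in_last:
  assumes "breaks_in f S" "0 < t" "t \<le> 1"
  obtains s k where "s \<in> Z_inv_6" "0 \<le> s" "s < t" "affine_piece f s t k"
    "s = 0 \<or> s \<in> S"
proof -
  define s where "s = Max (insert 0 (S \<inter> {0<..<t}))"
  have fin: "finite (insert 0 (S \<inter> {0<..<t}))"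
    using assms by (simp add: breaks_in_def)
  have mem: "s \<in> insert 0 (S \<inter> {0<..<t})"
    unfolding s_def by (rule Max_in[OF fin]) simp
  have "{s<..<t} \<inter> S = {}"
  proof (rule ccontr)
    assume "{s<..<t} \<inter> S \<noteq> {}"
    then obtain y where y: "s < y" "y < t" "y \<in> S" by auto
    have "0 \<le> s" using mem by auto
    then have "y \<le> s" unfolding s_def using y by (intro Max_ge[OF fin]) (auto simp: s_def)
    then show False using y by simp
  qed
  moreover have "0 \<le> s" "s < t" "s = 0 \<or> s \<in> S" using mem assms by auto
  moreover have "s \<in> Z_inv_6" using mem assms by (auto simp: breaks_in_def)
  ultimately show ?thesis
    using that assms unfolding breaks_in_def by metis
qed

text \<open>Induction from left to right along the pieces, whose ends may be taken in \<^term>\<open>Z_inv_6\<close>. A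
  subdivision that witnesses \<^term>\<open>PL_3_2 f\<close> need not have this property, since its points are
  unconstrained where the slope does not change.\<close>

lemma breaks_in_induct [consumes 4, case_names zero piece]:
  assumes "breaks_in f S" "t \<in> Z_inv_6" "0 \<le> t" "t \<le> 1"
    and zero: "P 0"
    and piece: "\<And>s t k. s \<in> Z_inv_6 \<Longrightarrow> t \<in> Z_inv_6 \<Longrightarrow> 0 \<le> s \<Longrightarrow> s < t \<Longrightarrow> t \<le> 1 \<Longrightarrow>
      affine_piece f s t k \<Longrightarrow> P s \<Longrightarrow> P t"
  shows "P t"
  using assms(2-4)
proof (induction "card (S \<inter> {0<..<t})" arbitrary: t rule: less_induct)
  case less
  show ?case
  proof (cases "t = 0")
    case True
    then show ?thesis using zero by simp
  next
    case False
    then obtain s k where s: "s \<in> Z_inv_6" "0 \<le> s" "s < t" "affine_piece f s t k" "s = 0 \<or> s \<in> S"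
      using breaks_in_last[OF assms(1), of t] less.prems by auto
    have "P s"
    proof (cases "s = 0")
      case True
      then show ?thesis using zero by simp
    next
      case False
      have "S \<inter> {0<..<s} \<subset> S \<inter> {0<..<t}" using s False by force
      then have "card (S \<inter> {0<..<s}) < card (S \<inter> {0<..<t})"
        using assms(1) by (intro psubset_card_mono) (auto simp: breaks_in_def)
      then show ?thesis using less.hyps s less.prems by simp
    qed
    then show ?thesis using piece s less.prems by blast
  qed
qed

lemma breaks_in_Z_inv_6:
  assumes "breaks_in f S" "t \<in> Z_inv_6" "0 \<le> t" "t \<le> 1" "f 0 \<in> Z_inv_6"
  shows "f t \<in> Z_inv_6"
  using assms(1-4)
proof (induction rule: breaks_in_induct)
  case zero
  then show ?case by (fact assms)
next
  case (piece s t k)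
  have "f t = f s + (3/2) powi k * (t - s)"
    by (rule affine_pieceD[OF piece(6)]) (use piece(4) in auto)
  then show ?case using piece by (simp add: Z_inv_6_add Z_inv_6_mult Z_inv_6_powi Z_inv_6_diff)
qed

lemma breaks_in_imp_PL_3_2:
  assumes "breaks_in f S" "f 0 \<in> Z_inv_6"
  shows "PL_3_2 f"
proof -
  define Q :: "real \<Rightarrow> nat \<Rightarrow> (nat \<Rightarrow> real) \<Rightarrow> (nat \<Rightarrow> int) \<Rightarrow> bool" where
    "Q t n x k \<longleftrightarrow> x 0 = 0 \<and> x n = t \<and> (\<forall>i<n. x i < x (Suc i)) \<and>
       (\<forall>i<n. affine_piece f (x i) (x (Suc i)) (k i)) \<and>
       (\<forall>i\<le>n. 0 \<le> x i \<and> x i \<le> t \<and> x i \<in> Z_inv_6)" for t n x k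
  have "\<exists>n x k. Q t n x k" if "t \<in> Z_inv_6" "0 \<le> t" "t \<le> 1" for t
    using assms(1) that
  proof (induction rule: breaks_in_induct)
    case zero
    have "Q 0 0 (\<lambda>_. 0) (\<lambda>_. 0)" by (simp add: Q_def)
    then show ?case by blast
  next
    case (piece s t k0)
    then obtain n x k where "Q s n x k" by blast
    note IH = this[unfolded Q_def]
    let ?x = "x(Suc n := t)" and ?k = "k(n := k0)"
    have "?x i < ?x (Suc i)" if "i < Suc n" for i
      using IH piece(4) that by (cases "i = n") auto
    moreover have "affine_piece f (?x i) (?x (Suc i)) (?k i)" if "i < Suc n" for i
      using IH piece(6) that by (cases "i = n") auto
    moreover have "0 \<le> ?x i \<and> ?x i \<le> t \<and> ?x i \<in> Z_inv_6" if "i \<le> Suc n" for i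
      using IH piece(2-5) that by (cases "i = Suc n") (force simp: le_Suc_eq)+
    ultimately have "Q t (Suc n) ?x ?k"
      using IH unfolding Q_def by simp
    then show ?case by blast
  qed
  from this[of 1] obtain n x k where "Q 1 n x k" by auto
  note * = this[unfolded Q_def]
  have "f (x i) \<in> Z_inv_6" if "i \<le> n" for i
    using breaks_in_Z_inv_6[OF assms(1) _ _ _ assms(2)] * that by blast
  then have "subdivision f n x k"
    unfolding subdivision_def using * by (auto simp: Suc_le_eq)
  then show ?thesis
    unfolding PL_3_2_iff by blast
qed

section \<open>The group structure\<close>

lemma F_carrier_iff:
  "f \<in> carrier F_3_2 \<longleftrightarrow> f \<in> extensional {0..1} \<and> (\<exists>g. homeomorphism {0..1} {0..1} f g) \<and>
     strict_mono_on {0..1} f \<and> PL_3_2 f"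
  by (simp add: F_3_2_def)

lemma F_mult: "t \<in> {0..1} \<Longrightarrow> (f \<otimes>\<^bsub>F_3_2\<^esub> g) t = g (f t)"
  by (simp add: F_3_2_def compose_def)

lemma F_one: "t \<in> {0..1} \<Longrightarrow> \<one>\<^bsub>F_3_2\<^esub> t = t"
  by (simp add: F_3_2_def)

lemma F_breaks: "f \<in> carrier F_3_2 \<Longrightarrow> \<exists>S. breaks_in f S"
  using PL_3_2_imp_breaks_in by (simp add: F_carrier_iff)

lemma F_image: "f \<in> carrier F_3_2 \<Longrightarrow> f ` {0..1} = {0..1}"
  by (auto simp: F_carrier_iff homeomorphism_def)

lemma F_in: "f \<in> carrier F_3_2 \<Longrightarrow> t \<in> {0..1} \<Longrightarrow> f t \<in> {0..1}"
  using F_image by blast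

lemma F_less_iff:
  "f \<in> carrier F_3_2 \<Longrightarrow> s \<in> {0..1} \<Longrightarrow> t \<in> {0..1} \<Longrightarrow> f s < f t \<longleftrightarrow> s < t"
  by (rule strict_mono_on_less[where S = "{0..1}"]) (auto simp: F_carrier_iff)

lemma F_le_iff:
  "f \<in> carrier F_3_2 \<Longrightarrow> s \<in> {0..1} \<Longrightarrow> t \<in> {0..1} \<Longrightarrow> f s \<le> f t \<longleftrightarrow> s \<le> t"
  by (rule strict_mono_on_less_eq[where S = "{0..1}"]) (auto simp: F_carrier_iff)

lemma F_eqI:
  assumes "f \<in> carrier F_3_2" "g \<in> carrier F_3_2" "\<And>t. t \<in> {0..1} \<Longrightarrow> f t = g t"
  shows "f = g"
  using assms by (auto simp: F_carrier_iff intro: extensionalityI)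

lemma F_0:
  assumes "f \<in> carrier F_3_2"
  shows "f 0 = 0"
proof -
  have "0 \<in> f ` {0..1}" using F_image[OF assms] by simp
  then obtain t where t: "0 = f t" "t \<in> {0..1}" by (rule imageE)
  then show ?thesis using F_le_iff[OF assms, of 0 t] F_in[OF assms, of 0] by auto
qed

lemma F_1:
  assumes "f \<in> carrier F_3_2"
  shows "f 1 = 1"
proof -
  have "1 \<in> f ` {0..1}" using F_image[OF assms] by simp
  then obtain t where t: "1 = f t" "t \<in> {0..1}" by (rule imageE)
  then show ?thesis using F_le_iff[OF assms, of t 1] F_in[OF assms, of 1] by auto
qed

text \<open>Slopes are units of the ring \<^term>\<open>Z_inv_6\<close> and 0 is fixed, so membership in the ring is
  transported along the pieces in both directions. This makes images and preimages of breaks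
  admissible as breaks.\<close>

lemma F_Z_inv_6_iff:
  assumes "f \<in> carrier F_3_2" "t \<in> {0..1}"
  shows "f t \<in> Z_inv_6 \<longleftrightarrow> t \<in> Z_inv_6"
proof
  obtain S where S: "breaks_in f S" using F_breaks[OF assms(1)] by blast
  have f0: "f 0 \<in> Z_inv_6" using F_0[OF assms(1)] by simp
  show "f t \<in> Z_inv_6" if "t \<in> Z_inv_6"
    using breaks_in_Z_inv_6[OF S that] assms f0 by simp
  assume ft: "f t \<in> Z_inv_6"
  show "t \<in> Z_inv_6"
  proof (cases "t = 0")
    case False
    then have "0 < t" "t \<le> 1" using assms by auto
    then obtain s k where s: "s \<in> Z_inv_6" "0 \<le> s" "s < t" "affine_piece f s t k"
      using breaks_in_last[OF S] by blast
    have "f s \<in> Z_inv_6" using breaks_in_Z_inv_6[OF S] s assms f0 by simp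
    moreover have "f t = f s + (3/2) powi k * (t - s)" by (rule affine_pieceD[OF s(4)]) (use s in auto)
    then have "t = s + (3/2) powi (- k) * (f t - f s)"
      by (simp add: power_int_minus field_simps)
    ultimately show ?thesis
      using s ft by (metis Z_inv_6_add Z_inv_6_diff Z_inv_6_mult Z_inv_6_powi)
  qed simp
qed

lemma F_intro:
  assumes "f \<in> extensional {0..1}" "homeomorphism {0..1} {0..1} f g" "strict_mono_on {0..1} f"
    "breaks_in f S" "f 0 = 0"
  shows "f \<in> carrier F_3_2"
  using assms breaks_in_imp_PL_3_2[of f S] by (auto simp: F_carrier_iff)

lemma F_one_closed: "\<one>\<^bsub>F_3_2\<^esub> \<in> carrier F_3_2"
proof (rule F_intro[where g = id and S = "{}"])
  show "homeomorphism {0..1} {0..1} \<one>\<^bsub>F_3_2\<^esub> id"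
    by (rule homeomorphism_cong[OF homeomorphism_ident]) (auto simp: F_one)
  have "affine_piece \<one>\<^bsub>F_3_2\<^esub> p q 0" if "0 \<le> p" "p < q" "q \<le> 1" for p q
    using that by (intro affine_pieceI) (simp add: F_one)
  then show "breaks_in \<one>\<^bsub>F_3_2\<^esub> {}"
    unfolding breaks_in_def by auto
qed (auto simp: F_one strict_mono_on_def, simp add: F_3_2_def)

lemma F_mult_closed:
  assumes f: "f \<in> carrier F_3_2" and g: "g \<in> carrier F_3_2"
  shows "f \<otimes>\<^bsub>F_3_2\<^esub> g \<in> carrier F_3_2"
proof -
  let ?h = "f \<otimes>\<^bsub>F_3_2\<^esub> g"
  obtain S where S: "breaks_in f S" using F_breaks[OF f] by blast
  obtain T where T: "breaks_in g T" using F_breaks[OF g] by blast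
  obtain f' where f': "homeomorphism {0..1} {0..1} f f'" using f by (auto simp: F_carrier_iff)
  obtain g' where g': "homeomorphism {0..1} {0..1} g g'" using g by (auto simp: F_carrier_iff)
  have "inj_on f {0..1}" using f by (simp add: F_carrier_iff strict_mono_on_imp_inj_on)
  then have fin: "finite (S \<union> (f -` T \<inter> {0..1}))"
    using S T by (auto simp: breaks_in_def intro: finite_vimage_IntI)
  have sub: "S \<union> (f -` T \<inter> {0..1}) \<subseteq> Z_inv_6"
    using S T F_Z_inv_6_iff[OF f] by (auto simp: breaks_in_def)
  have "\<exists>k. affine_piece ?h p q k"
    if pq: "0 \<le> p" "p < q" "q \<le> 1" "{p<..<q} \<inter> (S \<union> (f -` T \<inter> {0..1})) = {}" for p q
  proof -
    have "{p<..<q} \<inter> S = {}" using pq by blast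
    then obtain k where k: "affine_piece f p q k" using S pq unfolding breaks_in_def by blast
    have ord: "0 \<le> f p" "f p < f q" "f q \<le> 1"
      using pq F_in[OF f, of p] F_in[OF f, of q] F_less_iff[OF f, of p q] by auto
    have "{f p<..<f q} \<inter> T = {}"
    proof (rule ccontr)
      assume "{f p<..<f q} \<inter> T \<noteq> {}"
      then obtain y where y: "f p < y" "y < f q" "y \<in> T" by auto
      then have "y \<in> f ` {0..1}" using F_image[OF f] ord by auto
      then obtain t where t: "t \<in> {0..1}" "y = f t" by blast
      then have "p < t" "t < q" using y pq F_less_iff[OF f] by auto
      then show False using pq(4) t y by auto
    qed
    then obtain k' where k': "affine_piece g (f p) (f q) k'"
      using T ord unfolding breaks_in_def by blast
    have "affine_piece ?h p q (k + k')"
    proof (rule affine_pieceI)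
      fix t assume t: "p \<le> t" "t \<le> q"
      then have "f t \<in> {f p..f q}" using pq F_le_iff[OF f] by auto
      then have "g (f t) = g (f p) + (3/2) powi k' * (f t - f p)" by (intro affine_pieceD[OF k']) auto
      moreover have "f t - f p = (3/2) powi k * (t - p)" using affine_pieceD[OF k t] by simp
      ultimately show "?h t = ?h p + (3/2) powi (k + k') * (t - p)"
        using t pq by (simp add: F_mult power_int_add)
    qed
    then show ?thesis by blast
  qed
  then have brk: "breaks_in ?h (S \<union> (f -` T \<inter> {0..1}))"
    using fin sub unfolding breaks_in_def by simp
  show ?thesis
  proof (rule F_intro[OF _ _ _ brk])
    show "?h \<in> extensional {0..1}" by (simp add: F_3_2_def)
    show "homeomorphism {0..1} {0..1} ?h (f' \<circ> g')"
      by (rule homeomorphism_cong[OF homeomorphism_compose[OF f' g']]) (auto simp: F_mult)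
    show "strict_mono_on {0..1} ?h"
      using F_less_iff[OF f] F_less_iff[OF g] F_in[OF f] by (auto simp: strict_mono_on_def F_mult)
    show "?h 0 = 0" using F_0[OF f] F_0[OF g] by (simp add: F_mult)
  qed
qed

lemma F_left_inverse:
  assumes f: "f \<in> carrier F_3_2"
  shows "\<exists>g\<in>carrier F_3_2. g \<otimes>\<^bsub>F_3_2\<^esub> f = \<one>\<^bsub>F_3_2\<^esub>"
proof -
  obtain S where S: "breaks_in f S" using F_breaks[OF f] by blast
  obtain f' where f': "homeomorphism {0..1} {0..1} f f'" using f by (auto simp: F_carrier_iff)
  define g where "g = restrict f' {0..1}"
  have g_in: "g y \<in> {0..1}" and fg: "f (g y) = y" if "y \<in> {0..1}" for y
    using f' that by (auto simp: g_def homeomorphism_def)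
  have gf: "g (f t) = t" if "t \<in> {0..1}" for t
    using f' that F_in[OF f that] by (auto simp: g_def homeomorphism_def)
  have g_less: "g y < g z \<longleftrightarrow> y < z" if "y \<in> {0..1}" "z \<in> {0..1}" for y z
    using F_less_iff[OF f g_in[OF that(1)] g_in[OF that(2)]] that by (simp add: fg)
  have "\<exists>k. affine_piece g p q k"
    if pq: "0 \<le> p" "p < q" "q \<le> 1" "{p<..<q} \<inter> f ` (S \<inter> {0..1}) = {}" for p q
  proof -
    have mem: "p \<in> {0..1}" "q \<in> {0..1}" using pq by auto
    have ord: "0 \<le> g p" "g p < g q" "g q \<le> 1"
      using g_in[OF mem(1)] g_in[OF mem(2)] g_less[OF mem] pq by auto
    have "{g p<..<g q} \<inter> S = {}"
    proof (rule ccontr)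
      assume "{g p<..<g q} \<inter> S \<noteq> {}"
      then obtain t where t: "g p < t" "t < g q" "t \<in> S" by auto
      then have "t \<in> {0..1}" using ord by auto
      moreover have "p < f t" "f t < q"
        using F_less_iff[OF f g_in[OF mem(1)], of t] F_less_iff[OF f _ g_in[OF mem(2)], of t]
          t fg mem calculation by auto
      ultimately show False using pq(4) t by auto
    qed
    then obtain k where k: "affine_piece f (g p) (g q) k"
      using S ord unfolding breaks_in_def by blast
    have "affine_piece g p q (- k)"
    proof (rule affine_pieceI)
      fix y assume y: "p \<le> y" "y \<le> q"
      then have y1: "y \<in> {0..1}" using pq by auto
      have "g y \<in> {g p..g q}" using y g_less[OF mem(2) y1] g_less[OF y1 mem(1)] by auto
      then have "f (g y) = f (g p) + (3/2) powi k * (g y - g p)" by (intro affine_pieceD[OF k]) auto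
      then have "y = p + (3/2) powi k * (g y - g p)" using fg mem y1 by simp
      then show "g y = g p + (3/2) powi (- k) * (y - p)"
        by (simp add: power_int_minus field_simps)
    qed
    then show ?thesis by blast
  qed
  moreover have "f ` (S \<inter> {0..1}) \<subseteq> Z_inv_6"
    using S F_Z_inv_6_iff[OF f] by (auto simp: breaks_in_def)
  ultimately have brk: "breaks_in g (f ` (S \<inter> {0..1}))"
    using S unfolding breaks_in_def by auto
  have gF: "g \<in> carrier F_3_2"
  proof (rule F_intro[OF _ _ _ brk])
    show "homeomorphism {0..1} {0..1} g f"
      by (rule homeomorphism_cong[OF homeomorphism_symD[OF f']]) (auto simp: g_def)
    show "g 0 = 0" using gf[of 0] F_0[OF f] by simp
    show "strict_mono_on {0..1} g" unfolding strict_mono_on_def using g_less by blast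
  qed (simp add: g_def)
  moreover have "g \<otimes>\<^bsub>F_3_2\<^esub> f = \<one>\<^bsub>F_3_2\<^esub>"
    by (rule F_eqI[OF F_mult_closed[OF gF f] F_one_closed]) (simp add: F_mult F_one fg)
  ultimately show ?thesis by blast
qed

theorem group_F_3_2: "group F_3_2"
proof (rule groupI)
  fix f g h assume fgh: "f \<in> carrier F_3_2" "g \<in> carrier F_3_2" "h \<in> carrier F_3_2"
  show "f \<otimes>\<^bsub>F_3_2\<^esub> g \<otimes>\<^bsub>F_3_2\<^esub> h = f \<otimes>\<^bsub>F_3_2\<^esub> (g \<otimes>\<^bsub>F_3_2\<^esub> h)"
  proof (rule F_eqI)
    fix t :: real assume t: "t \<in> {0..1}"
    show "(f \<otimes>\<^bsub>F_3_2\<^esub> g \<otimes>\<^bsub>F_3_2\<^esub> h) t = (f \<otimes>\<^bsub>F_3_2\<^esub> (g \<otimes>\<^bsub>F_3_2\<^esub> h)) t"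
      using t F_in[OF fgh(1) t] by (simp add: F_mult)
  qed (use fgh in \<open>simp_all add: F_mult_closed\<close>)
next
  fix f assume f: "f \<in> carrier F_3_2"
  show "\<one>\<^bsub>F_3_2\<^esub> \<otimes>\<^bsub>F_3_2\<^esub> f = f"
    using f by (intro F_eqI) (auto simp: F_mult F_one F_mult_closed F_one_closed)
qed (auto simp: F_mult_closed F_one_closed F_left_inverse)

section \<open>Elementary stretches of the line\<close>

definition stretch :: "real \<Rightarrow> real \<Rightarrow> real \<Rightarrow> real" where
  "stretch a v t = t + max 0 (min v ((t - a) / 2))"

definition shrink :: "real \<Rightarrow> real \<Rightarrow> real \<Rightarrow> real" where
  "shrink a v t = t - max 0 (min v ((t - a) / 3))"

lemma shrink_stretch [simp]: "0 \<le> v \<Longrightarrow> shrink a v (stretch a v t) = t"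
  by (simp add: stretch_def shrink_def min_def max_def field_simps)

lemma stretch_shrink [simp]: "0 \<le> v \<Longrightarrow> stretch a v (shrink a v t) = t"
  by (simp add: stretch_def shrink_def min_def max_def field_simps)

lemma shrink_stretch_comp [simp]: "0 \<le> v \<Longrightarrow> shrink a v \<circ> stretch a v = id"
  and stretch_shrink_comp [simp]: "0 \<le> v \<Longrightarrow> stretch a v \<circ> shrink a v = id"
  by (simp_all add: fun_eq_iff)

lemma stretch_low: "t \<le> a \<Longrightarrow> stretch a v t = t" and shrink_low: "t \<le> a \<Longrightarrow> shrink a v t = t"
  by (auto simp: stretch_def shrink_def min_def max_def)

lemma stretch_mid: "a \<le> t \<Longrightarrow> t \<le> a + 2 * v \<Longrightarrow> stretch a v t = a + 3 / 2 * (t - a)"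
  by (simp add: stretch_def field_simps)

lemma stretch_high: "0 \<le> v \<Longrightarrow> a + 2 * v \<le> t \<Longrightarrow> stretch a v t = t + v"
  and shrink_high: "0 \<le> v \<Longrightarrow> a + 3 * v \<le> t \<Longrightarrow> shrink a v t = t - v"
  by (simp_all add: stretch_def shrink_def field_simps)

lemma stretch_0 [simp]: "stretch a 0 = id" and shrink_0 [simp]: "shrink a 0 = id"
  by (simp_all add: stretch_def shrink_def fun_eq_iff)

lemma stretch_scale: "0 < c \<Longrightarrow> stretch (c * a) (c * v) (c * t) = c * stretch a v t"
  and shrink_scale: "0 < c \<Longrightarrow> shrink (c * a) (c * v) (c * t) = c * shrink a v t"
  by (simp_all add: stretch_def shrink_def distrib_left right_diff_distrib
      max_mult_distrib_left min_mult_distrib_left)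

lemma stretch_translate: "stretch (a + b) v t = stretch a v (t - b) + b"
  and shrink_translate: "shrink (a + b) v t = shrink a v (t - b) + b"
  by (simp_all add: stretch_def shrink_def algebra_simps)

text \<open>A long stretch splits into two short ones, of which either the left or the right one may be
  applied first; the position of the second one depends on this choice.\<close>

lemma stretch_add: "0 \<le> u \<Longrightarrow> 0 \<le> v \<Longrightarrow> stretch a (u + v) = stretch (a + 3 * u) v \<circ> stretch a u"
  by (auto simp: fun_eq_iff stretch_def min_def max_def field_simps)

lemma shrink_add: "0 \<le> u \<Longrightarrow> 0 \<le> v \<Longrightarrow> shrink a (u + v) = shrink a u \<circ> shrink (a + 3 * u) v"
  by (auto simp: fun_eq_iff shrink_def min_def max_def field_simps)

lemma shrink_add': "0 \<le> u \<Longrightarrow> 0 \<le> v \<Longrightarrow> shrink a (u + v) = shrink (a + 2 * u) v \<circ> shrink a u"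
  by (auto simp: fun_eq_iff shrink_def min_def max_def field_simps)

text \<open>Far to the right of its start, a stretch acts by translation, so conjugation by it
  only moves the position of another stretch.\<close>

lemma stretch_shift:
  "0 \<le> u \<Longrightarrow> a + 2 * u \<le> b \<Longrightarrow> stretch (b + u) v \<circ> stretch a u = stretch a u \<circ> stretch b v"
  by (auto simp: fun_eq_iff stretch_def min_def max_def field_simps)

text \<open>A stretch at \<open>a\<close> that is undone at \<open>b\<close>. The position \<open>a\<close> may lie on either side of \<open>b\<close>; read as a
  relation between positions, membership of these maps in a group is an equivalence.\<close>

definition exchange :: "real \<Rightarrow> real \<Rightarrow> real \<Rightarrow> real \<Rightarrow> real" where
  "exchange a b v = shrink b v \<circ> stretch a v"

lemma exchange_trans: "0 \<le> v \<Longrightarrow> exchange b c v \<circ> exchange a b v = exchange a c v"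
  by (simp add: exchange_def fun_eq_iff)

lemma exchange_self [simp]: "0 \<le> v \<Longrightarrow> exchange a a v = id"
  by (simp add: exchange_def)

lemma exchange_low: "t \<le> a \<Longrightarrow> t \<le> b \<Longrightarrow> exchange a b v t = t"
  by (simp add: exchange_def stretch_low shrink_low)

lemma exchange_high: "0 \<le> v \<Longrightarrow> a + 2 * v \<le> t \<Longrightarrow> b + 2 * v \<le> t \<Longrightarrow> exchange a b v t = t"
  by (simp add: exchange_def stretch_high shrink_high)

lemma exchange_mono: "0 \<le> v \<Longrightarrow> s \<le> t \<Longrightarrow> exchange a b v s \<le> exchange a b v t"
  by (auto simp: exchange_def stretch_def shrink_def min_def max_def field_simps)

lemma exchange_scale: "0 < c \<Longrightarrow> exchange (c * a) (c * b) (c * v) (c * t) = c * exchange a b v t"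
  by (simp add: exchange_def stretch_scale shrink_scale)

text \<open>In the quotient of the exchange of width \<open>3/2 * v\<close> by the one of width \<open>v\<close> the parts of width \<open>v\<close>
  cancel at both ends. The second end is shifted by \<open>v / 2\<close> to compensate for the longer stretch, and
  the distance \<open>4 * v\<close> is what the stretches at the two ends need in order to commute up to
  translation.\<close>

lemma exchange_half:
  assumes "0 \<le> v" "a + 4 * v \<le> b"
  shows "exchange (a + 3 * v) (b + 5/2 * v) (v / 2) \<circ> exchange a b v = exchange a (b + v / 2) (3/2 * v)"
proof -
  have *: "shrink (b + v / 2) v \<circ> stretch (a + 3 * v) (v / 2) = stretch (a + 3 * v) (v / 2) \<circ> shrink b v"
    (is "?s' \<circ> ?g = ?g \<circ> ?s")
  proof -
    have "?s' \<circ> ?g = ?s' \<circ> (?g \<circ> stretch b v) \<circ> ?s"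
      using assms by (simp add: comp_assoc)
    also have "?g \<circ> stretch b v = stretch (b + v / 2) v \<circ> ?g"
      using assms by (simp add: stretch_shift)
    also have "?s' \<circ> (stretch (b + v / 2) v \<circ> ?g) \<circ> ?s = ?g \<circ> ?s"
      using assms by (simp flip: comp_assoc)
    finally show ?thesis .
  qed
  have "exchange a (b + v / 2) (3/2 * v) = shrink (b + v / 2) (v + v / 2) \<circ> stretch a (v + v / 2)"
    by (simp add: exchange_def)
  also have "\<dots> = shrink (b + v / 2 + 2 * v) (v / 2) \<circ> shrink (b + v / 2) v
                   \<circ> (stretch (a + 3 * v) (v / 2) \<circ> stretch a v)"
    using assms by (simp only: stretch_add shrink_add')
  also have "\<dots> = shrink (b + v / 2 + 2 * v) (v / 2) \<circ> (?s' \<circ> ?g) \<circ> stretch a v"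
    by (simp only: comp_assoc)
  also have "\<dots> = exchange (a + 3 * v) (b + v / 2 + 2 * v) (v / 2) \<circ> exchange a b v"
    unfolding * by (simp add: exchange_def comp_assoc)
  also have "b + v / 2 + 2 * v = b + 5/2 * v"
    by simp
  finally show ?thesis by (rule sym)
qed

section \<open>Telescoping the half-line into the interval\<close>

text \<open>The half-line beyond \<open>7/9\<close> is cut into intervals of length \<open>1/9\<close>, which are placed one after the
  other in the interval, each being \<open>2/3\<close> as long as its predecessor; \<open>n\<close> is the number of the
  interval that contains \<open>x\<close>. The functional equation \<open>telescope_add_ninth\<close> starts at \<open>6/9\<close>, where \<^const>\<open>r_map\<close>
  starts to contract towards 1; so \<^const>\<open>r_map\<close> lifts to a translation from there on.\<close>

definition telescope :: "real \<Rightarrow> real" where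
  "telescope x = (let n = nat (\<lceil>9 * x\<rceil> - 7) in 1 - (2/3) ^ n * (1 - (x - n / 9)))"

lemma telescope_low: "x \<le> 7/9 \<Longrightarrow> telescope x = x"
proof -
  assume "x \<le> 7/9"
  then have "nat (\<lceil>9 * x\<rceil> - 7) = 0" by (simp add: ceiling_le_iff)
  then show ?thesis by (simp add: telescope_def)
qed

lemma telescope_add_ninth:
  assumes "6/9 \<le> x"
  shows "telescope (x + 1/9) = 1/3 + 2/3 * telescope x"
proof (cases "x = 6/9")
  case True
  then show ?thesis by (simp add: telescope_low)
next
  case False
  then have "\<lceil>9 * x\<rceil> \<ge> 7"
    using assms by (simp add: le_ceiling_iff)
  moreover have "9 * (x + 1/9) = 9 * x + of_int 1"
    by simp
  then have "\<lceil>9 * (x + 1/9)\<rceil> = \<lceil>9 * x\<rceil> + 1"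
    by (simp only: ceiling_add_of_int)
  ultimately have "nat (\<lceil>9 * (x + 1/9)\<rceil> - 7) = Suc (nat (\<lceil>9 * x\<rceil> - 7))"
    by linarith
  then show ?thesis
    by (simp add: telescope_def Let_def field_simps)
qed

lemma telescope_high:
  assumes "7/9 \<le> x"
  shows "7/9 \<le> telescope x" "telescope x < 1"
proof -
  define n where "n = nat (\<lceil>9 * x\<rceil> - 7)"
  have "\<lceil>9 * x\<rceil> \<ge> 7"
    using assms by (simp add: le_ceiling_iff)
  then have n: "real n = real_of_int \<lceil>9 * x\<rceil> - 7"
    unfolding n_def by simp
  have up: "x - n / 9 \<le> 7/9"
    unfolding n using ceiling_correct[of "9 * x"] by (simp add: field_simps)
  have tel: "telescope x = 1 - (2/3) ^ n * (1 - (x - n / 9))"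
    by (simp add: telescope_def n_def Let_def)
  have pos: "0 < (2/3 :: real) ^ n" "(2/3 :: real) ^ n \<le> 1"
    by (simp_all add: power_le_one)
  show "telescope x < 1"
    using mult_pos_pos[OF pos(1), of "1 - (x - n / 9)"] up tel by linarith
  show "7/9 \<le> telescope x"
  proof (cases n)
    case 0
    then show ?thesis using tel assms by simp
  next
    case (Suc m)
    have "x - n / 9 \<ge> 6/9"
      unfolding n using ceiling_correct[of "9 * x"] by (simp add: field_simps)
    then have "(2/3) ^ m * (1 - (x - n / 9)) \<le> 1 * (1/3)"
      using up by (intro mult_mono) (auto simp: power_le_one)
    then show ?thesis using tel Suc by simp
  qed
qed

lemma telescope_in:
  assumes "0 \<le> x"
  shows "0 \<le> telescope x" "telescope x < 1"
  using telescope_low[of x] telescope_high[of x] assms by (cases "x \<le> 7/9"; force)+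

lemma telescope_surj:
  assumes "7/9 \<le> t" "t < 1"
  shows "\<exists>x\<ge>7/9. telescope x = t"
proof -
  have "\<exists>x\<ge>7/9. telescope x = t" if "7/9 \<le> t" "(2/3) ^ N \<le> 1 - t" for N t
    using that
  proof (induction N arbitrary: t)
    case 0
    then show ?case by simp
  next
    case (Suc N)
    let ?t = "1 - 3/2 * (1 - t)"
    show ?case
    proof (cases "7/9 \<le> ?t")
      case True
      moreover have "(2/3) ^ N \<le> 1 - ?t" using Suc.prems by simp
      ultimately obtain x where "x \<ge> 7/9" "telescope x = ?t" using Suc.IH by blast
      then show ?thesis
        using telescope_add_ninth[of x] by (intro exI[of _ "x + 1/9"]) (auto simp: field_simps)
    next
      case False
      then have "telescope ?t = ?t" "6/9 \<le> ?t" using Suc.prems by (auto intro: telescope_low)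
      then have "telescope (?t + 1/9) = 1/3 + 2/3 * ?t" using telescope_add_ninth[of ?t] by simp
      also have "\<dots> = t" by (simp add: field_simps)
      finally show ?thesis using Suc.prems by (intro exI[of _ "?t + 1/9"]) auto
    qed
  qed
  moreover obtain N where "(2/3 :: real) ^ N < 1 - t"
    using real_arch_pow_inv[of "1 - t" "2/3"] assms by auto
  ultimately show ?thesis
    using assms less_imp_le by blast
qed

section \<open>The subgroup generated by the two given elements\<close>

lemma exchange_eq:
  assumes "0 \<le> v" "a + 3 * v \<le> b"
  shows "exchange a b v t = (if t \<le> a then t else if t \<le> a + 2 * v then a + 3/2 * (t - a)
    else if t \<le> b - v then t + v else if t \<le> b + 2 * v then b + 2/3 * (t - (b - v)) else t)"
  using assms by (auto simp: exchange_def stretch_def shrink_def min_def max_def field_simps)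

lemma exchange_in_F:
  assumes "0 \<le> a" "0 \<le> v" "a + 3 * v \<le> b" "b + 2 * v \<le> 1"
    and A: "a \<in> Z_inv_6" "b \<in> Z_inv_6" "v \<in> Z_inv_6"
  shows "restrict (exchange a b v) {0..1} \<in> carrier F_3_2"
proof -
  let ?f = "restrict (exchange a b v) {0..1}"
  let ?S = "{a, a + 2 * v, b - v, b + 2 * v}"
  note eq = exchange_eq[OF assms(2,3)]
  have "\<exists>k. affine_piece ?f p q k"
    if pq: "0 \<le> p" "p < q" "q \<le> 1" "{p<..<q} \<inter> ?S = {}" for p q
  proof -
    have "affine_piece ?f p q (if p < a then 0 else if p < a + 2 * v then 1
        else if p < b - v then 0 else if p < b + 2 * v then - 1 else 0)" (is "affine_piece _ _ _ ?k")
    proof (rule affine_pieceI)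
      fix t assume t: "p \<le> t" "t \<le> q"
      have "a \<notin> {p<..<q}" "a + 2 * v \<notin> {p<..<q}" "b - v \<notin> {p<..<q}" "b + 2 * v \<notin> {p<..<q}"
        using pq(4) by blast+
      then have "exchange a b v t = exchange a b v p + (3/2) powi ?k * (t - p)"
        unfolding eq using t pq(2) assms(2,3) by (auto simp: power_int_minus field_simps)
      then show "?f t = ?f p + (3/2) powi ?k * (t - p)"
        using t pq by simp
    qed
    then show ?thesis by blast
  qed
  moreover have "?S \<subseteq> Z_inv_6"
    using A Z_inv_6_mult[OF Z_inv_6_of_int[of 2] A(3)] by (auto intro: Z_inv_6_add Z_inv_6_diff)
  ultimately have brk: "breaks_in ?f ?S"
    unfolding breaks_in_def by auto
  have cont: "continuous_on {0..1} (exchange c d v)" for c d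
    unfolding exchange_def stretch_def shrink_def comp_def by (intro continuous_intros) auto
  have inv: "exchange c d v (exchange d c v t) = t" for c d t
    using assms by (simp add: exchange_def)
  have bound: "exchange c d v t \<in> {0..1}"
    if "t \<in> {0..1}" "0 \<le> c" "0 \<le> d" "c + 2 * v \<le> 1" "d + 2 * v \<le> 1" for c d t
    using exchange_mono[of v 0 t c d] exchange_mono[of v t 1 c d] exchange_low[of 0 c d v]
      exchange_high[of v c 1 d] that assms by auto
  have hom: "homeomorphism {0..1} {0..1} (exchange a b v) (exchange b a v)"
  proof (rule homeomorphismI[OF cont cont])
    show "exchange a b v ` {0..1} \<subseteq> {0..1}" "exchange b a v ` {0..1} \<subseteq> {0..1}"
      by (rule image_subsetI, rule bound; use assms in simp)+
  qed (simp_all add: inv)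
  show ?thesis
  proof (rule F_intro[OF _ _ _ brk])
    show "homeomorphism {0..1} {0..1} ?f (exchange b a v)"
      by (rule homeomorphism_cong[OF hom]) auto
    have "exchange a b v s < exchange a b v t" if "s < t" for s t
      using exchange_mono[of v s t a b] inv[of b a s] inv[of b a t] that assms
      by (metis less_eq_real_def order_less_irrefl)
    then show "strict_mono_on {0..1} ?f"
      by (auto simp: strict_mono_on_def)
    show "?f 0 = 0"
      using assms by (simp add: exchange_low)
  qed simp
qed

lemma l_map_eq: "l_map = restrict (exchange 0 (4/9) (1/9)) {0..1}"
  by (auto simp: l_map_def exchange_eq restrict_def fun_eq_iff field_simps)

lemma r_map_eq: "r_map = restrict (exchange (3/9) (7/9) (1/9)) {0..1}"
  by (auto simp: r_map_def exchange_eq restrict_def fun_eq_iff field_simps)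

lemma l_map_in_F: "l_map \<in> carrier F_3_2"
  unfolding l_map_eq using Z_inv_6_frac[of 16 2] by (intro exchange_in_F Z_inv_6_ninth) simp_all

lemma r_map_in_F: "r_map \<in> carrier F_3_2"
  unfolding r_map_eq using Z_inv_6_frac[of 12 2] Z_inv_6_frac[of 28 2]
  by (intro exchange_in_F Z_inv_6_ninth) simp_all

abbreviation lr_group :: "(real \<Rightarrow> real) set" where
  "lr_group \<equiv> generate F_3_2 {l_map, r_map}"

lemma lr_group_sub: "h \<in> lr_group \<Longrightarrow> h \<in> carrier F_3_2"
  using group.generate_in_carrier[OF group_F_3_2, of "{l_map, r_map}"] l_map_in_F r_map_in_F by blast

section \<open>Lifts to the half-line\<close>

text \<open>The lifts are maps of the whole line, extended by the identity on the negative numbers, so that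
  they compose without domain conditions.\<close>

definition lifted :: "(real \<Rightarrow> real) set" where
  "lifted = {f. (\<forall>x<0. f x = x) \<and> (\<forall>x\<ge>0. 0 \<le> f x) \<and>
     (\<exists>h\<in>lr_group. \<forall>x\<ge>0. h (telescope x) = telescope (f x))}"

lemma telescope_unit: "0 \<le> x \<Longrightarrow> telescope x \<in> {0..1}"
  using telescope_in[of x] by simp

lemma lifted_comp:
  assumes "f \<in> lifted" "g \<in> lifted"
  shows "f \<circ> g \<in> lifted"
proof -
  obtain h where h: "h \<in> lr_group" "\<And>x. x \<ge> 0 \<Longrightarrow> h (telescope x) = telescope (f x)"
    using assms(1) unfolding lifted_def by blast
  obtain k where k: "k \<in> lr_group" "\<And>x. x \<ge> 0 \<Longrightarrow> k (telescope x) = telescope (g x)"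
    using assms(2) unfolding lifted_def by blast
  have "k \<otimes>\<^bsub>F_3_2\<^esub> h \<in> lr_group"
    using h k by (intro generate.eng)
  moreover have "(k \<otimes>\<^bsub>F_3_2\<^esub> h) (telescope x) = telescope ((f \<circ> g) x)" if "x \<ge> 0" for x
    using that assms by (simp add: F_mult telescope_unit[simplified] h(2) k(2) lifted_def)
  ultimately show ?thesis
    using assms unfolding lifted_def by auto
qed

lemma lifted_inverse:
  assumes "f \<in> lifted" and inv: "f \<circ> g = id" "g \<circ> f = id"
  shows "g \<in> lifted"
proof -
  interpret group F_3_2 by (rule group_F_3_2)
  have fg: "f (g x) = x" "g (f x) = x" for x
    using inv by (metis comp_apply id_apply)+
  obtain h where h: "h \<in> lr_group" "\<And>x. x \<ge> 0 \<Longrightarrow> h (telescope x) = telescope (f x)"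
    and f: "\<And>x. x < 0 \<Longrightarrow> f x = x" "\<And>x. x \<ge> 0 \<Longrightarrow> 0 \<le> f x"
    using assms(1) unfolding lifted_def by blast
  have g: "0 \<le> g x" if "x \<ge> 0" for x
    using f(1)[of "g x"] that fg(1)[of x] by linarith
  have "inv\<^bsub>F_3_2\<^esub> h \<in> lr_group"
    using h l_map_in_F r_map_in_F by (intro generate_m_inv_closed) auto
  moreover have "(inv\<^bsub>F_3_2\<^esub> h) (telescope x) = telescope (g x)" if "x \<ge> 0" for x
  proof -
    have "(inv\<^bsub>F_3_2\<^esub> h) (telescope x) = (h \<otimes>\<^bsub>F_3_2\<^esub> inv\<^bsub>F_3_2\<^esub> h) (telescope (g x))"
      using h(2)[of "g x"] g[OF that] fg(1)[of x] telescope_unit[of "g x"] by (simp add: F_mult)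
    then show ?thesis
      using h(1) g[OF that] telescope_unit[of "g x"] by (simp add: lr_group_sub F_one)
  qed
  moreover have "g x = x" if "x < 0" for x
    using fg(2)[of x] f(1)[OF that] by simp
  ultimately show ?thesis
    using g unfolding lifted_def by blast
qed

lemma lifted_id: "id \<in> lifted"
proof -
  have "\<forall>x\<ge>0. \<one>\<^bsub>F_3_2\<^esub> (telescope x) = telescope (id x)"
    using telescope_unit by (simp add: F_one)
  then show ?thesis
    unfolding lifted_def using generate.one[of F_3_2 "{l_map, r_map}"] by auto
qed

lemma lifted_conj_iff:
  assumes "g \<in> lifted" "g \<circ> g' = id" "g' \<circ> g = id" "g \<circ> f = f' \<circ> g"
  shows "f \<in> lifted \<longleftrightarrow> f' \<in> lifted"
proof -
  have g': "g' \<in> lifted" using lifted_inverse assms by blast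
  have "f' = g \<circ> f \<circ> g'" "f = g' \<circ> f' \<circ> g"
    using assms(2-4) by (metis comp_assoc comp_id id_comp)+
  then show ?thesis
    using lifted_comp g' assms(1) by metis
qed

lemma lifted_stretch_iff: "0 \<le> v \<Longrightarrow> stretch a v \<in> lifted \<longleftrightarrow> shrink a v \<in> lifted"
  using lifted_inverse[of "stretch a v" "shrink a v"] lifted_inverse[of "shrink a v" "stretch a v"]
  by auto

lemma lifted_l: "exchange 0 (4/9) (1/9) \<in> lifted"
proof -
  let ?e = "exchange 0 (4/9) (1/9)"
  have "l_map (telescope x) = telescope (?e x)" if "0 \<le> x" for x
  proof (cases "x \<le> 7/9")
    case True
    then have "?e x \<le> 7/9"
      using exchange_mono[of "1/9" x "7/9" 0 "4/9"] exchange_high[of "1/9" 0 "7/9" "4/9"] by simp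
    then show ?thesis
      using True that by (simp add: telescope_low l_map_eq)
  next
    case False
    then have "?e x = x" "?e (telescope x) = telescope x"
      using telescope_high[of x] by (auto intro!: exchange_high)
    then show ?thesis
      using telescope_unit[OF that] by (simp add: l_map_eq)
  qed
  moreover have "l_map \<in> lr_group" by (auto intro: generate.incl)
  moreover have "?e x = x" if "x < 0" for x
    using that by (simp add: exchange_low)
  moreover have "0 \<le> ?e x" if "0 \<le> x" for x
    using exchange_mono[of "1/9" 0 x 0 "4/9"] that by (simp add: exchange_low)
  ultimately show ?thesis
    unfolding lifted_def by blast
qed

lemma lifted_r: "stretch (3/9) (1/9) \<in> lifted"
proof -
  let ?g = "stretch (3/9) (1/9)"
  have "r_map (telescope x) = telescope (?g x)" if "0 \<le> x" for x
  proof (cases "x \<le> 6/9")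
    case True
    then have g: "?g x \<le> 7/9" by (auto simp: stretch_def min_def max_def field_simps)
    then have "exchange (3/9) (7/9) (1/9) x = ?g x"
      unfolding exchange_def by (simp add: shrink_low)
    then show ?thesis
      using True that g by (simp add: telescope_low r_map_eq)
  next
    case False
    then have "?g x = x + 1/9" by (intro stretch_high) auto
    moreover have "6/9 < telescope x"
      using False telescope_low[of x] telescope_high(1)[of x] by (cases "x \<le> 7/9") auto
    ultimately show ?thesis
      using telescope_unit[OF that] telescope_add_ninth[of x] False by (simp add: r_map_def)
  qed
  moreover have "r_map \<in> lr_group" by (auto intro: generate.incl)
  moreover have "?g x = x" if "x < 0" for x
    using that by (simp add: stretch_low)
  moreover have "0 \<le> ?g x" if "0 \<le> x" for x
    using that by (simp add: stretch_def)
  ultimately show ?thesis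
    unfolding lifted_def by blast
qed

text \<open>The contraction in \<^const>\<open>l_map\<close> is cancelled by \<^const>\<open>r_map\<close>, after the latter has been moved
  past the stretch at 0.\<close>

lemma lifted_stretch_0_ninth: "stretch 0 (1/9) \<in> lifted"
proof -
  have "exchange 0 (4/9) (1/9) \<circ> stretch (3/9) (1/9)
      = shrink (4/9) (1/9) \<circ> (stretch 0 (1/9) \<circ> stretch (3/9) (1/9))"
    by (simp add: exchange_def comp_assoc)
  also have "stretch 0 (1/9) \<circ> stretch (3/9) (1/9) = stretch (4/9) (1/9) \<circ> stretch 0 (1/9)"
    using stretch_shift[of "1/9" 0 "3/9" "1/9"] by simp
  also have "shrink (4/9) (1/9) \<circ> (stretch (4/9) (1/9) \<circ> stretch 0 (1/9)) = stretch 0 (1/9)"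
    by (simp flip: comp_assoc)
  finally have eq: "exchange 0 (4/9) (1/9) \<circ> stretch (3/9) (1/9) = stretch 0 (1/9)" .
  show ?thesis
    using lifted_comp[OF lifted_l lifted_r] unfolding eq .
qed

definition translate :: "real \<Rightarrow> (real \<Rightarrow> real) \<Rightarrow> real \<Rightarrow> real" where
  "translate c f t = f (t - c) + c"

lemma translate_0 [simp]: "translate 0 f = f"
  by (simp add: translate_def fun_eq_iff)

lemma translate_translate: "translate b (translate c f) = translate (b + c) f"
  by (simp add: translate_def fun_eq_iff algebra_simps)

lemma translate_comp: "translate c (f \<circ> g) = translate c f \<circ> translate c g"
  by (simp add: translate_def fun_eq_iff)

lemma translate_stretch: "translate c (stretch a v) = stretch (a + c) v"
  and translate_shrink: "translate c (shrink a v) = shrink (a + c) v"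
  by (simp_all add: translate_def fun_eq_iff stretch_translate shrink_translate)

lemma translate_exchange: "translate c (exchange a b v) = exchange (a + c) (b + c) v"
  by (simp add: exchange_def translate_comp translate_stretch translate_shrink)

text \<open>On maps that live beyond \<open>2/9\<close>, conjugation by \<^term>\<open>stretch 0 (1/9)\<close> is the translation by \<open>1/9\<close>.\<close>

lemma lifted_translate_ninth_iff:
  assumes "\<And>t. t \<le> 2/9 \<Longrightarrow> f t = t" "\<And>t. 2/9 \<le> t \<Longrightarrow> 2/9 \<le> f t"
  shows "f \<in> lifted \<longleftrightarrow> translate (1/9) f \<in> lifted"
proof (rule lifted_conj_iff[OF lifted_stretch_0_ninth])
  show "stretch 0 (1/9) \<circ> f = translate (1/9) f \<circ> stretch 0 (1/9)"
  proof
    fix t :: real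
    show "(stretch 0 (1/9) \<circ> f) t = (translate (1/9) f \<circ> stretch 0 (1/9)) t"
    proof (cases "t \<le> 2/9")
      case True
      then have "stretch 0 (1/9) t - 1/9 \<le> 2/9"
        by (auto simp: stretch_def min_def max_def)
      then show ?thesis
        using True assms(1) by (simp add: translate_def)
    next
      case False
      then show ?thesis
        using assms(2)[of t] by (simp add: translate_def stretch_high)
    qed
  qed
qed (rule stretch_shrink_comp shrink_stretch_comp, simp)+

lemma lifted_translate_iff:
  assumes "\<And>t. t \<le> 2/9 \<Longrightarrow> f t = t" "\<And>t. 2/9 \<le> t \<Longrightarrow> 2/9 \<le> f t"
  shows "f \<in> lifted \<longleftrightarrow> translate (real n / 9) f \<in> lifted"
proof (induction n)
  case (Suc n)
  have "translate (real n / 9) f \<in> lifted \<longleftrightarrow> translate (1/9) (translate (real n / 9) f) \<in> lifted"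
  proof (rule lifted_translate_ninth_iff)
    show "translate (real n / 9) f t = t" if "t \<le> 2/9" for t
      using assms(1)[of "t - real n / 9"] that by (simp add: translate_def)
    show "2/9 \<le> translate (real n / 9) f t" if "2/9 \<le> t" for t
    proof (cases "t - real n / 9 \<le> 2/9")
      case True
      then show ?thesis using assms(1)[of "t - real n / 9"] that by (simp add: translate_def)
    next
      case False
      then show ?thesis
        using assms(2)[of "t - real n / 9"] that by (simp add: translate_def add_increasing2)
    qed
  qed
  then show ?case
    using Suc by (simp add: translate_translate add_divide_distrib)
qed simp

lemma lifted_stretch_ninth:
  assumes "3 \<le> n"
  shows "stretch (real n / 9) (1/9) \<in> lifted"
proof -
  have "stretch (3/9) (1/9) \<in> lifted \<longleftrightarrow> translate (real (n - 3) / 9) (stretch (3/9) (1/9)) \<in> lifted"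
    by (rule lifted_translate_iff) (auto simp: stretch_low stretch_def)
  then show ?thesis
    using lifted_r assms by (simp add: translate_stretch of_nat_diff add_divide_distrib diff_divide_distrib)
qed

text \<open>Consecutive stretches join to a long one because \<open>3 * (n/9)\<close>, the end of the image of the first
  part, is again a multiple of \<open>1/9\<close>.\<close>

lemma lifted_stretch_0: "stretch 0 (real n / 9) \<in> lifted"
proof (induction n)
  case 0
  then show ?case using lifted_id by (simp only: of_nat_0 div_0 stretch_0)
next
  case (Suc n)
  have "stretch 0 (real (Suc n) / 9) = stretch (real (3 * n) / 9) (1/9) \<circ> stretch 0 (real n / 9)"
    using stretch_add[of "real n / 9" "1/9" 0] by (simp add: add_divide_distrib add.commute)
  moreover have "stretch (real (3 * n) / 9) (1/9) \<in> lifted"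
    using lifted_stretch_0_ninth lifted_stretch_ninth[of "3 * n"] by (cases "n = 0") auto
  ultimately show ?case
    using Suc lifted_comp by metis
qed

section \<open>Scaling and translation of exchanges\<close>

text \<open>On a segment that contains its support, an exchange is conjugated to its scaled copy by a long
  stretch at 0.\<close>

lemma lifted_exchange_scale:
  assumes "0 \<le> a" "0 \<le> b" "0 \<le> v"
  shows "exchange a b v \<in> lifted \<longleftrightarrow> exchange (3/2 * a) (3/2 * b) (3/2 * v) \<in> lifted"
proof -
  obtain n :: nat where n: "9 / 2 * (max a b + 2 * v) \<le> real n"
    using real_arch_simple by blast
  define M where "M = 2 * (real n / 9)"
  have M: "a + 2 * v \<le> M" "b + 2 * v \<le> M" "0 \<le> M"
    using n by (auto simp: M_def)
  let ?g = "stretch 0 (real n / 9)" and ?e' = "exchange (3/2 * a) (3/2 * b) (3/2 * v)"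
  have conj: "?g \<circ> exchange a b v = ?e' \<circ> ?g"
  proof
    fix t :: real
    consider "t \<le> 0" | "0 \<le> t" "t \<le> M" | "M \<le> t" by linarith
    then show "(?g \<circ> exchange a b v) t = (?e' \<circ> ?g) t"
    proof cases
      case 1
      then show ?thesis using assms by (simp add: exchange_low stretch_low)
    next
      case 2
      then have "0 \<le> exchange a b v t" "exchange a b v t \<le> M"
        using exchange_mono[of v 0 t a b] exchange_mono[of v t M a b] assms M
        by (auto simp: exchange_low exchange_high)
      then show ?thesis
        using 2 exchange_scale[of "3/2" a b v t] by (simp add: stretch_mid M_def)
    next
      case 3
      moreover have "?e' (t + real n / 9) = t + real n / 9"
        using M assms 3 by (intro exchange_high) (auto simp: M_def)
      ultimately show ?thesis
        using assms M by (simp add: exchange_high stretch_high M_def)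
    qed
  qed
  show ?thesis
    by (rule lifted_conj_iff[OF lifted_stretch_0 stretch_shrink_comp shrink_stretch_comp conj]) simp_all
qed

lemma lifted_exchange_translate:
  assumes "2/9 \<le> a" "2/9 \<le> b" "0 \<le> v"
  shows "exchange a b v \<in> lifted \<longleftrightarrow> exchange (a + real n / 9) (b + real n / 9) v \<in> lifted"
proof -
  have "exchange a b v \<in> lifted \<longleftrightarrow> translate (real n / 9) (exchange a b v) \<in> lifted"
  proof (rule lifted_translate_iff)
    show "exchange a b v t = t" if "t \<le> 2/9" for t
      using that assms by (intro exchange_low) auto
    show "2/9 \<le> exchange a b v t" if "2/9 \<le> t" for t
      using exchange_mono[of v "2/9" t a b] exchange_low[of "2/9" a b v] that assms by simp
  qed
  then show ?thesis by (simp add: translate_exchange)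
qed

abbreviation unit_exchange :: "real \<Rightarrow> real \<Rightarrow> real \<Rightarrow> real" where
  "unit_exchange a v \<equiv> exchange a (a + v) v"

lemma unit_exchange_scale:
  "0 \<le> a \<Longrightarrow> 0 \<le> v \<Longrightarrow> unit_exchange a v \<in> lifted \<longleftrightarrow> unit_exchange (3/2 * a) (3/2 * v) \<in> lifted"
  using lifted_exchange_scale[of a "a + v" v] by (simp add: distrib_left)

text \<open>Translations are only usable far out, because the translation by \<open>1/9\<close> needs support beyond \<open>2/9\<close>
  and scaling changes this bound. The bound is the same for all widths \<open>v\<close>, which is what makes
  \<open>far_shift_scale\<close> work.\<close>

definition far_shift :: "real \<Rightarrow> bool" where
  "far_shift c \<longleftrightarrow> (\<exists>K. \<forall>a v. K \<le> a \<and> 0 \<le> v \<longrightarrow>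
     (unit_exchange a v \<in> lifted \<longleftrightarrow> unit_exchange (a + c) v \<in> lifted))"

lemma far_shiftI:
  "(\<And>a v. K \<le> a \<Longrightarrow> 0 \<le> v \<Longrightarrow> unit_exchange a v \<in> lifted \<longleftrightarrow> unit_exchange (a + c) v \<in> lifted) \<Longrightarrow>
    far_shift c"
  unfolding far_shift_def by blast

lemma far_shift_ninth: "far_shift (1/9)"
proof (rule far_shiftI[of "2/9"])
  fix a v :: real assume "2/9 \<le> a" "0 \<le> v"
  then show "unit_exchange a v \<in> lifted \<longleftrightarrow> unit_exchange (a + 1/9) v \<in> lifted"
    using lifted_exchange_translate[of a "a + v" v 1] by (simp add: algebra_simps)
qed

lemma far_shift_add:
  assumes "far_shift b" "far_shift c"
  shows "far_shift (b + c)"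
proof -
  obtain K L where
    K: "\<And>a v. K \<le> a \<Longrightarrow> 0 \<le> v \<Longrightarrow> unit_exchange a v \<in> lifted \<longleftrightarrow> unit_exchange (a + b) v \<in> lifted" and
    L: "\<And>a v. L \<le> a \<Longrightarrow> 0 \<le> v \<Longrightarrow> unit_exchange a v \<in> lifted \<longleftrightarrow> unit_exchange (a + c) v \<in> lifted"
    using assms unfolding far_shift_def by blast
  show ?thesis
    by (rule far_shiftI[of "max K (L - b)"]) (simp add: K L flip: add.assoc)
qed

lemma far_shift_minus:
  assumes "far_shift c"
  shows "far_shift (- c)"
proof -
  obtain K where
    K: "\<And>a v. K \<le> a \<Longrightarrow> 0 \<le> v \<Longrightarrow> unit_exchange a v \<in> lifted \<longleftrightarrow> unit_exchange (a + c) v \<in> lifted"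
    using assms unfolding far_shift_def by blast
  show ?thesis
    using K[of "_ - c"] by (intro far_shiftI[of "K + c"]) simp
qed

lemma far_shift_scale:
  assumes "far_shift c"
  shows "far_shift (3/2 * c)" "far_shift (2/3 * c)"
proof -
  obtain K where
    K: "\<And>a v. K \<le> a \<Longrightarrow> 0 \<le> v \<Longrightarrow> unit_exchange a v \<in> lifted \<longleftrightarrow> unit_exchange (a + c) v \<in> lifted"
    using assms unfolding far_shift_def by blast
  show "far_shift (3/2 * c)"
  proof (rule far_shiftI[of "3/2 * max K (max 0 (- c))"])
    fix a v :: real assume "3/2 * max K (max 0 (- c)) \<le> a" and v: "0 \<le> v"
    then have a: "max K (max 0 (- c)) \<le> 2/3 * a" by simp
    have "unit_exchange a v \<in> lifted \<longleftrightarrow> unit_exchange (2/3 * a) (2/3 * v) \<in> lifted"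
      using unit_exchange_scale[of "2/3 * a" "2/3 * v"] a v by simp
    also have "\<dots> \<longleftrightarrow> unit_exchange (2/3 * a + c) (2/3 * v) \<in> lifted"
      using a v by (intro K) auto
    also have "\<dots> \<longleftrightarrow> unit_exchange (a + 3/2 * c) v \<in> lifted"
      using unit_exchange_scale[of "2/3 * a + c" "2/3 * v"] a v by (simp add: distrib_left)
    finally show "unit_exchange a v \<in> lifted \<longleftrightarrow> unit_exchange (a + 3/2 * c) v \<in> lifted" .
  qed
  show "far_shift (2/3 * c)"
  proof (rule far_shiftI[of "2/3 * max K (max 0 (- c))"])
    fix a v :: real assume "2/3 * max K (max 0 (- c)) \<le> a" and v: "0 \<le> v"
    then have a: "max K (max 0 (- c)) \<le> 3/2 * a" by simp
    have "unit_exchange a v \<in> lifted \<longleftrightarrow> unit_exchange (3/2 * a) (3/2 * v) \<in> lifted"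
      using unit_exchange_scale[of a v] a v by simp
    also have "\<dots> \<longleftrightarrow> unit_exchange (3/2 * a + c) (3/2 * v) \<in> lifted"
      using a v by (intro K) auto
    also have "\<dots> \<longleftrightarrow> unit_exchange (a + 2/3 * c) v \<in> lifted"
      using unit_exchange_scale[of "a + 2/3 * c" v] a v by (simp add: distrib_left)
    finally show "unit_exchange a v \<in> lifted \<longleftrightarrow> unit_exchange (a + 2/3 * c) v \<in> lifted" .
  qed
qed

text \<open>\<open>1/2 = 3/2 - 1\<close> and \<open>1/3 = 1 - 2/3\<close>.\<close>

lemma far_shift_div_6: "far_shift c \<Longrightarrow> far_shift (c / 6)"
proof -
  have half: "far_shift (c / 2)" if "far_shift c" for c
    using far_shift_add[OF far_shift_scale(1)[OF that] far_shift_minus[OF that]] by simp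
  have third: "far_shift (c / 3)" if "far_shift c" for c
    using far_shift_add[OF that far_shift_minus[OF far_shift_scale(2)[OF that]]] by simp
  show "far_shift (c / 6)" if "far_shift c"
    using third[OF half[OF that]] by simp
qed

lemma far_shift_Z_inv_6:
  assumes "c \<in> Z_inv_6"
  shows "far_shift c"
proof -
  obtain i n where c: "c = of_int i / 6 ^ n"
    using assms unfolding Z_inv_6_def by blast
  have nat: "far_shift (real m * (1/9))" for m
  proof (induction m)
    case 0
    then show ?case by (intro far_shiftI) simp
  next
    case (Suc m)
    have "real (Suc m) * (1/9) = real m * (1/9) + 1/9" by (simp add: field_simps)
    then show ?case using far_shift_add[OF Suc far_shift_ninth] by (simp only:)
  qed
  have "far_shift (real_of_int i)"
    using nat[of "9 * nat i"] far_shift_minus[OF nat[of "9 * nat (- i)"]] by (cases "0 \<le> i") auto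
  then have "far_shift (real_of_int i / 6 ^ n)" for n
  proof (induction n)
    case (Suc n)
    then show ?case using far_shift_div_6[of "real_of_int i / 6 ^ n"] by (simp add: mult.commute)
  qed simp
  then show ?thesis unfolding c .
qed

definition far_exchange :: "real \<Rightarrow> bool" where
  "far_exchange v \<longleftrightarrow> (\<exists>K. \<forall>a\<in>Z_inv_6. K \<le> a \<longrightarrow> unit_exchange a v \<in> lifted)"

text \<open>At multiples of \<open>1/9\<close> both parts of the exchange are lifted. A position \<open>a\<close> is reached from
  these by going far to the right, shifting by \<open>a - 1/3\<close>, and coming back.\<close>

lemma far_exchange_ninth: "far_exchange (1/9)"
proof -
  have "unit_exchange a (1/9) \<in> lifted" if a: "a \<in> Z_inv_6" "2/9 \<le> a" for a
  proof -
    have "1/3 \<in> Z_inv_6" using Z_inv_6_frac[of 2 1] by simp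
    then obtain K where K: "\<And>b. K \<le> b \<Longrightarrow>
        unit_exchange b (1/9) \<in> lifted \<longleftrightarrow> unit_exchange (b + (a - 1/3)) (1/9) \<in> lifted"
      using far_shift_Z_inv_6[OF Z_inv_6_diff[OF a(1)]] unfolding far_shift_def
      by (metis zero_le_divide_1_iff zero_le_numeral)
    obtain N :: nat where N: "9 * K \<le> real N"
      using real_arch_simple by blast
    have eq: "real (N + 3) / 9 + 1/9 = real (N + 4) / 9"
      by (simp add: field_simps)
    have "shrink (real (N + 3) / 9 + 1/9) (1/9) \<in> lifted"
      unfolding eq using lifted_stretch_ninth[of "N + 4"] lifted_stretch_iff by simp
    then have "unit_exchange (real (N + 3) / 9) (1/9) \<in> lifted"
      unfolding exchange_def by (intro lifted_comp lifted_stretch_ninth) simp_all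
    then have "unit_exchange (a + real N / 9) (1/9) \<in> lifted"
      using K[of "real (N + 3) / 9"] N by (simp add: add_divide_distrib add.commute)
    then show ?thesis
      using lifted_exchange_translate[of a "a + 1/9" "1/9" N] a by (simp add: algebra_simps)
  qed
  then show ?thesis unfolding far_exchange_def by blast
qed

lemma far_exchange_scale:
  assumes "far_exchange v" "0 \<le> v"
  shows "far_exchange (3/2 * v)" "far_exchange (2/3 * v)"
proof -
  obtain K where K: "\<And>a. a \<in> Z_inv_6 \<Longrightarrow> K \<le> a \<Longrightarrow> unit_exchange a v \<in> lifted"
    using assms(1) unfolding far_exchange_def by blast
  have frac: "2/3 \<in> Z_inv_6" "3/2 \<in> Z_inv_6"
    using Z_inv_6_frac[of 4 1] Z_inv_6_frac[of 9 1] by simp_all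
  have "unit_exchange a (3/2 * v) \<in> lifted" if "a \<in> Z_inv_6" "3/2 * max K 0 \<le> a" for a
    using K[OF Z_inv_6_mult[OF frac(1) that(1)]] unit_exchange_scale[of "2/3 * a" v] that assms(2)
    by simp
  then show "far_exchange (3/2 * v)" unfolding far_exchange_def by blast
  have "unit_exchange a (2/3 * v) \<in> lifted" if "a \<in> Z_inv_6" "2/3 * max K 0 \<le> a" for a
    using K[OF Z_inv_6_mult[OF frac(2) that(1)]] unit_exchange_scale[of a "2/3 * v"] that assms(2)
    by simp
  then show "far_exchange (2/3 * v)" unfolding far_exchange_def by blast
qed

lemma lifted_exchange_inverse:
  assumes "exchange a b v \<in> lifted" "0 \<le> v"
  shows "exchange b a v \<in> lifted"
  using lifted_inverse[OF assms(1), of "exchange b a v"] assms(2) by (simp add: exchange_trans)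

lemma lifted_exchange_trans:
  assumes "exchange a b v \<in> lifted" "exchange b c v \<in> lifted" "0 \<le> v"
  shows "exchange a c v \<in> lifted"
  using lifted_comp[OF assms(2,1)] assms(3) by (simp add: exchange_trans)

lemma lifted_exchange_multiple:
  assumes K: "\<And>a. a \<in> Z_inv_6 \<Longrightarrow> K \<le> a \<Longrightarrow> unit_exchange a v \<in> lifted"
    and "0 \<le> v" "v \<in> Z_inv_6" "a \<in> Z_inv_6" "K \<le> a"
  shows "exchange a (a + real n * v) v \<in> lifted"
proof (induction n)
  case 0
  then show ?case
    using lifted_id exchange_self[OF assms(2), of a]
    by (simp only: of_nat_0 mult_zero_left add_0_right)
next
  case (Suc n)
  have "real n * v \<in> Z_inv_6"
    using Z_inv_6_mult[OF Z_inv_6_of_int[of "int n"] assms(3)] by simp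
  then have "unit_exchange (a + real n * v) v \<in> lifted"
    using assms by (intro K Z_inv_6_add) (auto intro: add_increasing2)
  then show ?case
    using lifted_exchange_trans[OF Suc _ assms(2)] by (simp add: algebra_simps)
qed

text \<open>The lemma \<open>exchange_half\<close> applies to distances \<open>n * v\<close> for which \<open>n * v + v / 2\<close> is a multiple of
  \<open>3/2 * v\<close>. The values \<open>n = 4\<close> and \<open>n = 7\<close> give the new distances 7 and 13 in units of \<open>v / 2\<close>, and the
  distance 1 results from \<open>2 * 7 - 13\<close>.\<close>

lemma far_exchange_half:
  assumes "far_exchange v" "0 \<le> v" "v \<in> Z_inv_6"
  shows "far_exchange (v / 2)"
proof -
  obtain K where K: "\<And>a. a \<in> Z_inv_6 \<Longrightarrow> K \<le> a \<Longrightarrow> unit_exchange a v \<in> lifted"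
    using assms(1) unfolding far_exchange_def by blast
  obtain L where L: "\<And>a. a \<in> Z_inv_6 \<Longrightarrow> L \<le> a \<Longrightarrow> unit_exchange a (3/2 * v) \<in> lifted"
    using far_exchange_scale(1)[OF assms(1,2)] unfolding far_exchange_def by blast
  define M where "M = max K L"
  have half: "v / 2 \<in> Z_inv_6" "3/2 * v \<in> Z_inv_6"
    using Z_inv_6_mult[OF Z_inv_6_half assms(3)] Z_inv_6_mult[OF Z_inv_6_frac[of 9 1] assms(3)] by auto
  have v3: "3 * v \<in> Z_inv_6"
    using Z_inv_6_mult[OF Z_inv_6_of_int[of 3] assms(3)] by simp
  have step: "exchange (a + 3 * v) (a + real n * v + 5/2 * v) (v / 2) \<in> lifted"
    if a: "a \<in> Z_inv_6" "M \<le> a" and n: "4 \<le> n" "real n + 1/2 = 3/2 * real m" for a n m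
  proof -
    have 1: "exchange a (a + real n * v) v \<in> lifted"
      using a assms by (intro lifted_exchange_multiple[where K = K] K) (auto simp: M_def)
    have "exchange a (a + real m * (3/2 * v)) (3/2 * v) \<in> lifted"
      using a assms half by (intro lifted_exchange_multiple[where K = L] L) (auto simp: M_def)
    also have "real m * (3/2 * v) = (3/2 * real m) * v"
      by simp
    also have "\<dots> = real n * v + v / 2"
      unfolding n(2)[symmetric] by (simp add: algebra_simps)
    finally have 2: "exchange a (a + real n * v + v / 2) (3/2 * v) \<in> lifted"
      by (simp add: add.assoc)
    have "4 * v \<le> real n * v"
      using n(1) assms(2) by (intro mult_right_mono) auto
    then have eq: "exchange (a + 3 * v) (a + real n * v + 5/2 * v) (v / 2) \<circ> exchange a (a + real n * v) v
        = exchange a (a + real n * v + v / 2) (3/2 * v)"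
      using assms(2) by (intro exchange_half) auto
    have "exchange a (a + real n * v + v / 2) (3/2 * v) \<circ> exchange (a + real n * v) a v
        = exchange (a + 3 * v) (a + real n * v + 5/2 * v) (v / 2)"
      unfolding eq[symmetric]
      by (simp only: comp_assoc exchange_trans[OF assms(2)] exchange_self[OF assms(2)] comp_id)
    then show ?thesis
      using lifted_comp[OF 2 lifted_exchange_inverse[OF 1 assms(2)]] by (simp only:)
  qed
  have "unit_exchange a (v / 2) \<in> lifted" if a: "a \<in> Z_inv_6" "M + 3 * v \<le> a" for a
  proof -
    have sub: "b - 3 * v \<in> Z_inv_6" if "b \<in> Z_inv_6" for b
      using that v3 by (rule Z_inv_6_diff)
    have short: "exchange b (b + 7/2 * v) (v / 2) \<in> lifted" if "b \<in> Z_inv_6" "M + 3 * v \<le> b" for b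
      using step[of "b - 3 * v" 4 3] sub that by (simp add: algebra_simps)
    have long: "exchange b (b + 13/2 * v) (v / 2) \<in> lifted" if "b \<in> Z_inv_6" "M + 3 * v \<le> b" for b
      using step[of "b - 3 * v" 7 5] sub that by (simp add: algebra_simps)
    have A: "a + 7/2 * v \<in> Z_inv_6" "a + v / 2 \<in> Z_inv_6"
      using Z_inv_6_add[OF a(1) half(1)] Z_inv_6_add[OF Z_inv_6_add[OF a(1) half(1)] v3]
      by (simp_all add: algebra_simps)
    have "exchange a (a + 7 * v) (v / 2) \<in> lifted"
      using lifted_exchange_trans[OF short[OF a] short[OF A(1)]] a assms(2) by (simp add: add.commute)
    moreover have "exchange (a + v / 2) (a + 7 * v) (v / 2) \<in> lifted"
      using long[OF A(2)] a assms(2) by (simp add: add.commute)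
    moreover have "0 \<le> v / 2" using assms(2) by simp
    ultimately show ?thesis
      using lifted_exchange_trans lifted_exchange_inverse by blast
  qed
  then show ?thesis unfolding far_exchange_def by blast
qed

lemma far_exchange_lattice: "far_exchange (1 / (9 * 6 ^ m))"
proof (induction m)
  case 0
  then show ?case using far_exchange_ninth by simp
next
  case (Suc m)
  let ?v = "1 / (9 * 6 ^ m) :: real"
  have v: "?v \<in> Z_inv_6"
    using Z_inv_6_frac[of 4 "m + 2"] by simp
  have "far_exchange (2/3 * (?v / 2))"
    using far_exchange_scale(2)[OF far_exchange_half[OF Suc _ v]] by simp
  moreover have "2/3 * (?v / 2) \<in> Z_inv_6"
    using Z_inv_6_mult[OF Z_inv_6_frac[of 2 1] v] by simp
  ultimately have "far_exchange (2/3 * (?v / 2) / 2)"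
    by (intro far_exchange_half) auto
  then show ?case by simp
qed

section \<open>Words in lattice stretches\<close>

inductive_set lattice_words :: "real \<Rightarrow> (real \<Rightarrow> real) set" for v where
  id: "id \<in> lattice_words v"
| stretch: "f \<in> lattice_words v \<Longrightarrow> stretch (of_int i * v) v \<circ> f \<in> lattice_words v"
| shrink: "f \<in> lattice_words v \<Longrightarrow> shrink (of_int i * v) v \<circ> f \<in> lattice_words v"

lemma lattice_words_comp:
  assumes "f \<in> lattice_words v" "g \<in> lattice_words v"
  shows "f \<circ> g \<in> lattice_words v"
  using assms(1)
proof induction
  case id
  show ?case using assms(2) by (simp only: id_comp)
next
  case (stretch f i)
  show ?case unfolding comp_assoc by (rule lattice_words.stretch[OF stretch.IH])
next
  case (shrink f i)
  show ?case unfolding comp_assoc by (rule lattice_words.shrink[OF shrink.IH])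
qed

lemma lattice_words_multiple:
  assumes "0 \<le> v"
  shows "stretch (of_int i * v) (real n * v) \<in> lattice_words v"
    and "shrink (of_int i * v) (real n * v) \<in> lattice_words v"
proof (induction n)
  case 0
  show "stretch (of_int i * v) (real 0 * v) \<in> lattice_words v"
    and "shrink (of_int i * v) (real 0 * v) \<in> lattice_words v"
    by (simp_all only: of_nat_0 mult_zero_left stretch_0 shrink_0 lattice_words.id)
next
  case (Suc n)
  have single: "stretch (of_int j * v) v \<in> lattice_words v" "shrink (of_int j * v) v \<in> lattice_words v" for j
    using lattice_words.stretch[OF lattice_words.id] lattice_words.shrink[OF lattice_words.id]
    by (simp_all only: comp_id)
  have len: "real (Suc n) * v = real n * v + v"
    by (simp add: algebra_simps)
  have pos: "of_int i * v + 3 * (real n * v) = of_int (i + 3 * int n) * v"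
    by (simp add: algebra_simps)
  have n: "0 \<le> real n * v"
    using assms by simp
  show "stretch (of_int i * v) (real (Suc n) * v) \<in> lattice_words v"
    unfolding len stretch_add[OF n assms] pos by (rule lattice_words_comp[OF single(1) Suc(1)])
  show "shrink (of_int i * v) (real (Suc n) * v) \<in> lattice_words v"
    unfolding len shrink_add[OF n assms] pos by (rule lattice_words_comp[OF Suc(2) single(2)])
qed

text \<open>A ramp is a signed stretch. It serves as a reference map of prescribed translation length at a
  fixed position \<open>b\<close>, by which a word is compensated.\<close>

definition ramp :: "real \<Rightarrow> real \<Rightarrow> real \<Rightarrow> real" where
  "ramp b x = (if 0 \<le> x then stretch b x else shrink b (- x))"

definition unramp :: "real \<Rightarrow> real \<Rightarrow> real \<Rightarrow> real" where
  "unramp b x = (if 0 \<le> x then shrink b x else stretch b (- x))"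

lemma ramp_unramp [simp]: "ramp b x (unramp b x t) = t" and unramp_ramp [simp]: "unramp b x (ramp b x t) = t"
  by (simp_all add: ramp_def unramp_def)

text \<open>One more stretch, compensated by ramps, is a single exchange: the stretch is moved past the first
  ramp, where its position changes by \<open>n\<close> units, and the two ramps cancel except for one shrink, whose
  position depends on the sign of \<open>n\<close>.\<close>

lemma ramp_stretch_lifted:
  fixes i n L :: int
  assumes "0 < v" and i: "L + 3 * \<bar>n\<bar> \<le> i"
    and exch: "\<And>i j :: int. L \<le> i \<Longrightarrow> L \<le> j \<Longrightarrow> exchange (of_int i * v) (of_int j * v) v \<in> lifted"
  shows "unramp (of_int L * v) (of_int (n + 1) * v) \<circ> stretch (of_int i * v) v \<circ> ramp (of_int L * v) (of_int n * v) \<in> lifted"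
proof -
  let ?B = "of_int L * v :: real"
  note shift = stretch_shift[THEN fun_cong, unfolded comp_apply]
  note add = stretch_add[THEN fun_cong, unfolded comp_apply]
  show ?thesis
  proof (cases "0 \<le> n")
    case True
    let ?e = "L + 2 * n"
    have nv: "0 \<le> of_int n * v"
      using True assms(1) by simp
    have "of_int (L + 2 * n) * v \<le> of_int (i - n) * v"
      using i True assms(1) by (intro mult_right_mono) linarith+
    then have far: "?B + 2 * (of_int n * v) \<le> of_int (i - n) * v"
      by (simp add: algebra_simps)
    have "unramp ?B (of_int (n + 1) * v) (stretch (of_int i * v) v (ramp ?B (of_int n * v) t))
        = exchange (of_int (i - n) * v) (of_int ?e * v) v t" for t
    proof -
      have "stretch (of_int i * v) v (ramp ?B (of_int n * v) t)
          = stretch ?B (of_int n * v) (stretch (of_int (i - n) * v) v t)"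
        using shift[OF nv far, of v t] nv by (simp add: ramp_def algebra_simps)
      moreover have "unramp ?B (of_int (n + 1) * v) y
          = shrink (?B + 2 * (of_int n * v)) v (shrink ?B (of_int n * v) y)" for y
        using shrink_add'[THEN fun_cong, unfolded comp_apply, of "of_int n * v" v ?B y] True assms(1)
        by (simp add: unramp_def distrib_right)
      moreover have "?B + 2 * (of_int n * v) = of_int ?e * v"
        by (simp add: algebra_simps)
      ultimately show ?thesis
        using nv by (simp add: exchange_def)
    qed
    then have "unramp ?B (of_int (n + 1) * v) \<circ> stretch (of_int i * v) v \<circ> ramp ?B (of_int n * v)
        = exchange (of_int (i - n) * v) (of_int ?e * v) v"
      unfolding fun_eq_iff comp_apply by blast
    then show ?thesis
      using exch[of "i - n" ?e] i True by simp
  next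
    case False
    let ?m = "- n" let ?e = "L + 3 * (- n - 1)"
    define x where "x = of_int (- n - 1) * v"
    have x: "0 \<le> x" using False assms(1) by (simp add: x_def)
    have mv: "- (of_int n * v) = x + v" by (simp add: x_def algebra_simps)
    have "of_int (L + 2 * - n) * v \<le> of_int i * v"
      using i False assms(1) by (intro mult_right_mono) linarith+
    then have far: "?B + 2 * (x + v) \<le> of_int i * v"
      by (simp add: x_def algebra_simps)
    have "unramp ?B (of_int (n + 1) * v) (stretch (of_int i * v) v (ramp ?B (of_int n * v) t))
        = exchange (of_int (i - n) * v) (of_int ?e * v) v t" for t
    proof -
      define s where "s = ramp ?B (of_int n * v) t"
      have "of_int n * v < 0" using False assms(1) by (simp add: mult_neg_pos)
      then have "s = shrink ?B (x + v) t"
        unfolding s_def ramp_def mv by simp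
      then have t: "t = stretch ?B (x + v) s"
        using x assms(1) by simp
      have "stretch (of_int (i - n) * v) v t = stretch ?B (x + v) (stretch (of_int i * v) v s)"
        using shift[OF _ far, of v s] x assms(1) unfolding t by (simp add: x_def algebra_simps)
      also have "\<dots> = stretch (?B + 3 * x) v (stretch ?B x (stretch (of_int i * v) v s))"
        using add[OF x, of v] assms(1) by simp
      also have "?B + 3 * x = of_int ?e * v"
        by (simp add: x_def algebra_simps)
      finally have "exchange (of_int (i - n) * v) (of_int ?e * v) v t = stretch ?B x (stretch (of_int i * v) v s)"
        using assms(1) by (simp add: exchange_def)
      moreover have "unramp ?B (of_int (n + 1) * v) = stretch ?B x"
      proof (cases "n = - 1")
        case True
        then show ?thesis by (simp add: unramp_def x_def)
      next
        case n: False
        have "of_int (n + 1) * v < 0" using False n assms(1) by (intro mult_neg_pos) auto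
        moreover have "- (of_int (n + 1) * v) = x" by (simp add: x_def algebra_simps)
        ultimately show ?thesis by (simp add: unramp_def)
      qed
      ultimately show ?thesis by (simp add: s_def)
    qed
    then have "unramp ?B (of_int (n + 1) * v) \<circ> stretch (of_int i * v) v \<circ> ramp ?B (of_int n * v)
        = exchange (of_int (i - n) * v) (of_int ?e * v) v"
      unfolding fun_eq_iff comp_apply by blast
    then show ?thesis
      using exch[of "i - n" ?e] i False by simp
  qed
qed

text \<open>The statement quantifies over all far translates of \<open>f\<close> by lattice elements, since moving a ramp
  past a letter changes the position of the letter.\<close>

lemma lattice_words_lifted:
  fixes L :: int
  assumes v: "0 < v" and f: "f \<in> lattice_words v"
    and exch: "\<And>i j :: int. L \<le> i \<Longrightarrow> L \<le> j \<Longrightarrow> exchange (of_int i * v) (of_int j * v) v \<in> lifted"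
  shows "\<exists>n :: int. (\<exists>T. \<forall>t\<ge>T. f t = t + of_int n * v) \<and>
    (\<exists>M. \<forall>N\<ge>M. unramp (of_int L * v) (of_int n * v) \<circ> translate (of_int N * v) f \<in> lifted)"
  using f
proof induction
  case id
  have "unramp (of_int L * v) (of_int 0 * v) \<circ> translate c id = id" for c
    by (simp add: fun_eq_iff unramp_def translate_def)
  then have "unramp (of_int L * v) (of_int 0 * v) \<circ> translate (of_int N * v) id \<in> lifted" for N
    using lifted_id by (simp only:)
  moreover have "\<forall>t\<ge>0. id t = t + of_int 0 * v"
    by simp
  ultimately show ?case by blast
next
  case (stretch f j)
  let ?B = "of_int L * v :: real"
  obtain n :: int and T M where T: "\<And>t. T \<le> t \<Longrightarrow> f t = t + of_int n * v"
    and M: "\<And>N. M \<le> N \<Longrightarrow> unramp ?B (of_int n * v) \<circ> translate (of_int N * v) f \<in> lifted"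
    using stretch.IH by blast
  have "(stretch (of_int j * v) v \<circ> f) t = t + of_int (n + 1) * v"
    if "max T (of_int j * v + 2 * v - of_int n * v) \<le> t" for t
    using T[of t] that v by (simp add: stretch_high algebra_simps)
  moreover have "unramp ?B (of_int (n + 1) * v) \<circ> translate (of_int N * v) (stretch (of_int j * v) v \<circ> f) \<in> lifted"
    if N: "max M (L + 3 * \<bar>n\<bar> - j) \<le> N" for N
  proof -
    have A: "unramp ?B (of_int (n + 1) * v) \<circ> stretch (of_int (j + N) * v) v \<circ> ramp ?B (of_int n * v) \<in> lifted"
      by (rule ramp_stretch_lifted[OF v _ exch]) (use N in linarith)+
    have "unramp ?B (of_int n * v) \<circ> translate (of_int N * v) f \<in> lifted"
      using M N by simp
    note lifted_comp[OF A this]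
    moreover have "translate (of_int N * v) (stretch (of_int j * v) v \<circ> f)
        = stretch (of_int (j + N) * v) v \<circ> translate (of_int N * v) f"
      by (simp add: translate_comp translate_stretch distrib_right)
    ultimately show ?thesis
      by (simp add: comp_def)
  qed
  ultimately show ?case by blast
next
  case (shrink f j)
  let ?B = "of_int L * v :: real"
  obtain n :: int and T M where T: "\<And>t. T \<le> t \<Longrightarrow> f t = t + of_int n * v"
    and M: "\<And>N. M \<le> N \<Longrightarrow> unramp ?B (of_int n * v) \<circ> translate (of_int N * v) f \<in> lifted"
    using shrink.IH by blast
  have "(shrink (of_int j * v) v \<circ> f) t = t + of_int (n - 1) * v"
    if "max T (of_int j * v + 3 * v - of_int n * v) \<le> t" for t
    using T[of t] that v by (simp add: shrink_high algebra_simps)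
  moreover have "unramp ?B (of_int (n - 1) * v) \<circ> translate (of_int N * v) (shrink (of_int j * v) v \<circ> f) \<in> lifted"
    if N: "max M (L + 3 * \<bar>n - 1\<bar> - j) \<le> N" for N
  proof -
    have "unramp ?B (of_int (n - 1 + 1) * v) \<circ> stretch (of_int (j + N) * v) v \<circ> ramp ?B (of_int (n - 1) * v) \<in> lifted"
      by (rule ramp_stretch_lifted[OF v _ exch]) (use N in linarith)+
    then have A: "unramp ?B (of_int (n - 1) * v) \<circ> shrink (of_int (j + N) * v) v \<circ> ramp ?B (of_int n * v) \<in> lifted"
      by (rule lifted_inverse) (use v in \<open>simp_all add: fun_eq_iff\<close>)
    have "unramp ?B (of_int n * v) \<circ> translate (of_int N * v) f \<in> lifted"
      using M N by simp
    note lifted_comp[OF A this]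
    moreover have "translate (of_int N * v) (shrink (of_int j * v) v \<circ> f)
        = shrink (of_int (j + N) * v) v \<circ> translate (of_int N * v) f"
      by (simp add: translate_comp translate_shrink distrib_right)
    ultimately show ?thesis
      by (simp add: comp_def)
  qed
  ultimately show ?case by blast
qed

text \<open>Triviality far out forces the total translation length \<open>n\<close> of the word to vanish, and then no ramp
  is needed.\<close>

lemma lattice_words_far_lifted:
  assumes m: "f \<in> lattice_words (1 / (9 * 6 ^ m))" and T: "\<And>t. T \<le> t \<Longrightarrow> f t = t"
  shows "\<exists>M. \<forall>N\<ge>M. translate (of_int N * (1 / (9 * 6 ^ m))) f \<in> lifted"
proof -
  define v :: real where "v = 1 / (9 * 6 ^ m)"
  have v: "0 < v" "v \<in> Z_inv_6"
    using Z_inv_6_frac[of 4 "m + 2"] by (simp_all add: v_def)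
  obtain K where K: "\<And>a. a \<in> Z_inv_6 \<Longrightarrow> K \<le> a \<Longrightarrow> unit_exchange a v \<in> lifted"
    using far_exchange_lattice[of m] unfolding far_exchange_def v_def by blast
  define L where "L = \<lceil>K / v\<rceil>"
  have L: "K \<le> of_int i * v" if "L \<le> i" for i
    using that v(1) by (simp add: L_def ceiling_le_iff pos_divide_le_eq)
  have up: "exchange (of_int i * v) (of_int j * v) v \<in> lifted" if "L \<le> i" "i \<le> j" for i j
  proof -
    have "exchange (of_int i * v) (of_int i * v + real (nat (j - i)) * v) v \<in> lifted"
      using K v L[OF that(1)] Z_inv_6_mult[OF Z_inv_6_of_int v(2)]
      by (intro lifted_exchange_multiple[where K = K]) auto
    also have "of_int i * v + real (nat (j - i)) * v = of_int j * v"
      using that by (simp add: algebra_simps)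
    finally show ?thesis .
  qed
  have "exchange (of_int i * v) (of_int j * v) v \<in> lifted" if "L \<le> i" "L \<le> j" for i j
    using up[of i j] lifted_exchange_inverse[OF up[of j i]] that v(1) by (cases "i \<le> j") auto
  from lattice_words_lifted[OF v(1) m[folded v_def] this]
  obtain n :: int and T' M where T': "\<And>t. T' \<le> t \<Longrightarrow> f t = t + of_int n * v"
    and M: "\<And>N. M \<le> N \<Longrightarrow> unramp (of_int L * v) (of_int n * v) \<circ> translate (of_int N * v) f \<in> lifted"
    by blast
  have "of_int n * v = 0"
    using T[of "max T T'"] T'[of "max T T'"] by simp
  moreover have "unramp b 0 = id" for b
    by (simp add: unramp_def fun_eq_iff)
  ultimately have "translate (of_int N * v) f \<in> lifted" if "M \<le> N" for N
    using M[OF that] by (simp only: id_comp)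
  then show ?thesis unfolding v_def by blast
qed

section \<open>Elements of the group as words\<close>

lemma eventually_stretch_word:
  assumes "a \<in> Z_inv_6" "u \<in> Z_inv_6" "0 \<le> u"
  shows "\<forall>\<^sub>F m in sequentially. stretch a u \<in> lattice_words (1 / (9 * 6 ^ m)) \<and>
     shrink a u \<in> lattice_words (1 / (9 * 6 ^ m))"
  using Z_inv_6_eventually_lattice[OF assms(1)] Z_inv_6_eventually_lattice[OF assms(2)]
proof eventually_elim
  case (elim m)
  let ?v = "1 / (9 * 6 ^ m) :: real"
  obtain i j where ij: "a = of_int i * ?v" "u = of_int j * ?v" using elim by blast
  have "0 \<le> j"
    using assms(3) unfolding ij(2) by (simp add: zero_le_divide_iff power_le_zero_eq)
  then have "u = real (nat j) * ?v"
    using ij(2) by simp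
  then show ?case
    unfolding ij(1) using lattice_words_multiple[of ?v i "nat j"] by simp
qed

lemma eventually_comp_word:
  assumes "\<forall>\<^sub>F m in sequentially. f \<in> lattice_words (1 / (9 * 6 ^ m))"
    and "\<forall>\<^sub>F m in sequentially. g \<in> lattice_words (1 / (9 * 6 ^ m))"
  shows "\<forall>\<^sub>F m in sequentially. f \<circ> g \<in> lattice_words (1 / (9 * 6 ^ m))"
  using assms by eventually_elim (rule lattice_words_comp)

text \<open>The form in which the pieces of an element are split off one at a time: one piece of slope
  \<open>(3/2) powi k\<close>, continued by a translation, which leaves the slopes further right unchanged.\<close>

definition dilate :: "real \<Rightarrow> real \<Rightarrow> int \<Rightarrow> real \<Rightarrow> real" where
  "dilate a d k t = (if t \<le> a then t else if t \<le> a + d then a + (3/2) powi k * (t - a)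
     else t + ((3/2) powi k - 1) * d)"

lemma dilate_up:
  assumes "0 \<le> d"
  shows "dilate a d (k + 1) = stretch a ((3/2) powi k * d / 2) \<circ> dilate a d k"
proof
  fix t
  define c :: real where "c = (3/2) powi k"
  have c: "0 < c" "(3/2) powi (k + 1) = 3/2 * c" by (simp_all add: c_def power_int_add)
  consider "t \<le> a" | "a < t" "t \<le> a + d" | "a + d < t" by linarith
  then show "dilate a d (k + 1) t = (stretch a ((3/2) powi k * d / 2) \<circ> dilate a d k) t"
  proof cases
    case 1
    then show ?thesis by (simp add: dilate_def stretch_low)
  next
    case 2
    have "c * (t - a) \<le> c * d" "0 \<le> c * (t - a)" using 2 c by simp_all
    then have "stretch a (c * d / 2) (a + c * (t - a)) = a + 3/2 * (c * (t - a))"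
      by (subst stretch_mid) auto
    then show ?thesis using 2 c by (simp add: dilate_def c_def)
  next
    case 3
    have "0 \<le> c * d" using assms c by simp
    then have "stretch a (c * d / 2) (t + (c - 1) * d) = t + (c - 1) * d + c * d / 2"
      using 3 by (intro stretch_high) (auto simp: algebra_simps)
    then show ?thesis using 3 assms c by (simp add: dilate_def c_def algebra_simps)
  qed
qed

lemma dilate_down:
  assumes "0 \<le> d"
  shows "dilate a d (k - 1) = shrink a ((3/2) powi (k - 1) * d / 2) \<circ> dilate a d k"
proof -
  have "0 \<le> (3/2 :: real) powi (k - 1) * d / 2"
    using assms by simp
  then show ?thesis
    using dilate_up[OF assms, of a "k - 1"] by (simp add: fun_eq_iff)
qed

lemma dilate_word:
  assumes "a \<in> Z_inv_6" "d \<in> Z_inv_6" "0 \<le> d"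
  shows "\<forall>\<^sub>F m in sequentially. dilate a d k \<in> lattice_words (1 / (9 * 6 ^ m))"
proof -
  have "(3/2) powi k * d / 2 \<in> Z_inv_6" "0 \<le> (3/2 :: real) powi k * d / 2" for k
    using Z_inv_6_mult[OF Z_inv_6_mult[OF Z_inv_6_powi assms(2)] Z_inv_6_half] assms(3) by simp_all
  from eventually_stretch_word[OF assms(1) this]
  have words: "\<forall>\<^sub>F m in sequentially. stretch a ((3/2) powi k * d / 2) \<in> lattice_words (1 / (9 * 6 ^ m))"
    "\<forall>\<^sub>F m in sequentially. shrink a ((3/2) powi k * d / 2) \<in> lattice_words (1 / (9 * 6 ^ m))" for k
    unfolding eventually_conj_iff by blast+
  show ?thesis
  proof (induction k rule: int_induct[of _ 0])
    case base
    have "dilate a d 0 = id" by (simp add: dilate_def fun_eq_iff)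
    then show ?case by (simp only: lattice_words.id eventually_True)
  next
    case (step1 k)
    show ?case
      unfolding dilate_up[OF assms(3)] by (rule eventually_comp_word[OF words(1) step1(2)])
  next
    case (step2 k)
    show ?case
      unfolding dilate_down[OF assms(3)] by (rule eventually_comp_word[OF words(2) step2(2)])
  qed
qed

text \<open>The part of \<open>f\<close> up to \<open>s\<close>, continued by a translation; prolonging it by one piece amounts to the
  composition with one dilation.\<close>

definition head :: "(real \<Rightarrow> real) \<Rightarrow> real \<Rightarrow> real \<Rightarrow> real" where
  "head f s t = (if t \<le> 0 then t else if t \<le> s then f t else f s + (t - s))"

lemma head_word:
  assumes f: "f \<in> carrier F_3_2" and "s \<in> Z_inv_6" "0 \<le> s" "s \<le> 1"
  shows "\<forall>\<^sub>F m in sequentially. head f s \<in> lattice_words (1 / (9 * 6 ^ m))"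
proof -
  obtain S where "breaks_in f S" using F_breaks[OF f] by blast
  then show ?thesis
    using assms(2-4)
  proof (induction rule: breaks_in_induct)
    case zero
    have "head f 0 = id" using F_0[OF f] by (simp add: head_def fun_eq_iff)
    then show ?case by (simp only: lattice_words.id eventually_True)
  next
    case (piece s t k)
    have "head f t = dilate (f s) (t - s) k \<circ> head f s"
    proof
      fix y
      have fs: "0 \<le> f s" using F_in[OF f, of s] piece by simp
      consider "y \<le> 0" | "0 < y" "y \<le> s" | "s < y" "y \<le> t" | "t < y" using piece by linarith
      then show "head f t y = (dilate (f s) (t - s) k \<circ> head f s) y"
      proof cases
        case 1
        then show ?thesis using fs by (simp add: head_def dilate_def)
      next
        case 2
        then have "f y \<le> f s" using F_le_iff[OF f, of y s] piece by simp
        then show ?thesis using 2 piece by (simp add: head_def dilate_def)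
      next
        case 3
        then have "f y = f s + (3/2) powi k * (y - s)" using affine_pieceD[OF piece(6), of y] by simp
        then show ?thesis using 3 piece by (simp add: head_def dilate_def)
      next
        case 4
        have "f t = f s + (3/2) powi k * (t - s)" using affine_pieceD[OF piece(6), of t] piece by simp
        then show ?thesis using 4 piece by (simp add: head_def dilate_def algebra_simps)
      qed
    qed
    moreover have "f s \<in> Z_inv_6" "t - s \<in> Z_inv_6" "0 \<le> t - s"
      using F_Z_inv_6_iff[OF f] piece by (simp_all add: Z_inv_6_diff)
    ultimately show ?case
      using eventually_comp_word[OF dilate_word piece.IH] by (simp only:)
  qed
qed

text \<open>Where \<^const>\<open>telescope\<close> is the identity, a lift can be read off directly; so the map, extended by the
  identity to the line, is its own lift as soon as it is lifted at all. That it is lifted may be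
  checked after a translation far to the right.\<close>

lemma central_support_in_lr_group:
  assumes f: "f \<in> carrier F_3_2"
    and left: "\<And>t. 0 \<le> t \<Longrightarrow> t \<le> 2/9 \<Longrightarrow> f t = t" and right: "\<And>t. 7/9 \<le> t \<Longrightarrow> t \<le> 1 \<Longrightarrow> f t = t"
  shows "f \<in> lr_group"
proof -
  obtain m where m: "head f 1 \<in> lattice_words (1 / (9 * 6 ^ m))"
    using head_word[OF f, of 1] by (auto simp: eventually_sequentially)
  have f1: "f 1 = 1" using right by simp
  have "\<exists>M. \<forall>N\<ge>M. translate (of_int N * (1 / (9 * 6 ^ m))) (head f 1) \<in> lifted"
    by (rule lattice_words_far_lifted[OF m, of 2]) (simp add: head_def f1)
  then obtain M where M: "\<And>N. M \<le> N \<Longrightarrow> translate (of_int N * (1 / (9 * 6 ^ m))) (head f 1) \<in> lifted"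
    by blast
  obtain N :: nat where "M \<le> int N"
    using nat_le_iff by blast
  also have "int N * 1 \<le> int N * 6 ^ m"
    by (intro mult_left_mono) (simp_all add: one_le_power)
  finally have "translate (of_int (int N * 6 ^ m) * (1 / (9 * 6 ^ m))) (head f 1) \<in> lifted"
    by (intro M) simp
  then have "translate (real N / 9) (head f 1) \<in> lifted"
    by simp
  moreover have "head f 1 \<in> lifted \<longleftrightarrow> translate (real N / 9) (head f 1) \<in> lifted"
  proof (rule lifted_translate_iff)
    show "head f 1 t = t" if "t \<le> 2/9" for t
      using left[of t] that by (simp add: head_def)
    show "2/9 \<le> head f 1 t" if "2/9 \<le> t" for t
      using F_le_iff[OF f, of "2/9" t] left[of "2/9"] that f1 by (simp add: head_def)
  qed
  ultimately have "head f 1 \<in> lifted"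
    by blast
  then obtain h where h: "h \<in> lr_group" "\<And>x. 0 \<le> x \<Longrightarrow> h (telescope x) = telescope (head f 1 x)"
    unfolding lifted_def by blast
  have "f = h"
  proof (rule F_eqI[OF f lr_group_sub[OF h(1)]])
    fix t :: real assume t: "t \<in> {0..1}"
    consider "t \<le> 7/9" | "7/9 < t" "t < 1" | "t = 1" using t by fastforce
    then show "f t = h t"
    proof cases
      case 1
      then have ft: "f t \<le> 7/9" using F_le_iff[OF f, of t "7/9"] right[of "7/9"] t by simp
      have "head f 1 t = f t" using t left[of 0] by (auto simp: head_def)
      then show ?thesis using h(2)[of t] 1 t ft by (simp add: telescope_low)
    next
      case 2
      then obtain x where x: "7/9 \<le> x" "telescope x = t" using telescope_surj[of t] by auto
      have "head f 1 x = x" using x right[of x] f1 by (auto simp: head_def)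
      then show ?thesis using h(2)[of x] x right[of t] 2 by simp
    next
      case 3
      then show ?thesis using F_1[OF f] F_1[OF lr_group_sub[OF h(1)]] by simp
    qed
  qed
  then show ?thesis using h(1) by simp
qed

section \<open>Reduction to central support\<close>

context
begin

interpretation group F_3_2 by (rule group_F_3_2)

lemma lr_group_subgroup: "subgroup lr_group F_3_2"
  using l_map_in_F r_map_in_F by (intro generate_is_subgroup) auto

lemma l_in_lr_group: "l_map \<in> lr_group" and r_in_lr_group: "r_map \<in> lr_group"
  by (auto intro: generate.incl)

lemma F_inv:
  assumes "g \<in> carrier F_3_2" "t \<in> {0..1}"
  shows "(inv\<^bsub>F_3_2\<^esub> g) (g t) = t"
  using F_mult[OF assms(2), of g "inv\<^bsub>F_3_2\<^esub> g"] F_one[OF assms(2)] assms by (simp del: atLeastAtMost_iff)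

lemma lr_group_cancel:
  assumes "f \<in> carrier F_3_2" "g \<in> lr_group" "f \<otimes>\<^bsub>F_3_2\<^esub> g \<in> lr_group"
  shows "f \<in> lr_group"
proof -
  have "f = (f \<otimes>\<^bsub>F_3_2\<^esub> g) \<otimes>\<^bsub>F_3_2\<^esub> inv\<^bsub>F_3_2\<^esub> g"
    using assms lr_group_sub by (simp add: m_assoc)
  then show ?thesis
    using assms subgroup.m_closed[OF lr_group_subgroup] subgroup.m_inv_closed[OF lr_group_subgroup] by metis
qed

lemma lr_group_conj:
  assumes "f \<in> carrier F_3_2" "g \<in> lr_group" "inv\<^bsub>F_3_2\<^esub> g \<otimes>\<^bsub>F_3_2\<^esub> f \<otimes>\<^bsub>F_3_2\<^esub> g \<in> lr_group"
  shows "f \<in> lr_group"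
proof -
  have "inv\<^bsub>F_3_2\<^esub> g \<otimes>\<^bsub>F_3_2\<^esub> f \<in> lr_group"
    using assms lr_group_sub by (intro lr_group_cancel[OF _ assms(2,3)]) simp
  then have "g \<otimes>\<^bsub>F_3_2\<^esub> (inv\<^bsub>F_3_2\<^esub> g \<otimes>\<^bsub>F_3_2\<^esub> f) \<in> lr_group"
    using assms(2) subgroup.m_closed[OF lr_group_subgroup] by blast
  then show ?thesis
    using assms(1,2) lr_group_sub by (simp flip: m_assoc)
qed

lemma conj_fix:
  assumes "f \<in> carrier F_3_2" "g \<in> carrier F_3_2" "t \<in> {0..1}" "f t = t"
  shows "(inv\<^bsub>F_3_2\<^esub> g \<otimes>\<^bsub>F_3_2\<^esub> f \<otimes>\<^bsub>F_3_2\<^esub> g) (g t) = g t"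
  using assms F_in[OF assms(2,3)] by (simp add: F_mult F_inv del: atLeastAtMost_iff)

text \<open>Conjugation by \<^const>\<open>r_map\<close> enlarges the neighbourhood of 1 on which the map is the identity by the
  factor \<open>3/2\<close> until it contains \<open>{7/9..1}\<close>.\<close>

lemma small_germ_right:
  assumes "f \<in> carrier F_3_2"
    and "\<And>t. 0 \<le> t \<Longrightarrow> t \<le> 2/9 \<Longrightarrow> f t = t"
    and "\<And>t. 1 - 2/9 * (2/3) ^ n \<le> t \<Longrightarrow> t \<le> 1 \<Longrightarrow> f t = t"
  shows "f \<in> lr_group"
  using assms
proof (induction n arbitrary: f)
  case 0
  show ?case
    by (rule central_support_in_lr_group) (use 0 in auto)
next
  case (Suc n)
  let ?g = "inv\<^bsub>F_3_2\<^esub> r_map"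
  have g: "?g \<in> carrier F_3_2" using r_map_in_F by simp
  let ?f = "inv\<^bsub>F_3_2\<^esub> ?g \<otimes>\<^bsub>F_3_2\<^esub> f \<otimes>\<^bsub>F_3_2\<^esub> ?g"
  have *: "?f y = y" if "y \<in> {0..1}" "f (r_map y) = r_map y" for y
    using conj_fix[OF Suc.prems(1) g F_in[OF r_map_in_F that(1)] that(2)] F_inv[OF r_map_in_F that(1)]
    by simp
  have "?f \<in> lr_group"
  proof (rule Suc.IH)
    show "?f \<in> carrier F_3_2" using g Suc.prems(1) by simp
    show "?f t = t" if "0 \<le> t" "t \<le> 2/9" for t
      using that Suc.prems(2)[of t] by (intro *) (auto simp: r_map_def)
    show "?f t = t" if t: "1 - 2/9 * (2/3) ^ n \<le> t" "t \<le> 1" for t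
    proof -
      have "(2/3 :: real) ^ n \<le> 1" by (simp add: power_le_one)
      then have "7/9 \<le> t" using t by linarith
      then have "r_map t = 2 * t / 3 + 1/3" using t by (simp add: r_map_def)
      then show ?thesis
        using t \<open>7/9 \<le> t\<close> by (intro *) (auto intro!: Suc.prems(3))
    qed
  qed
  then show ?case
    using lr_group_conj[OF Suc.prems(1)] subgroup.m_inv_closed[OF lr_group_subgroup r_in_lr_group] by blast
qed

text \<open>Conjugation by \<^const>\<open>l_map\<close> does the same at 0, and does not disturb \<open>{7/9..1}\<close>.\<close>

lemma small_germs:
  assumes "f \<in> carrier F_3_2"
    and "\<And>t. 0 \<le> t \<Longrightarrow> t \<le> 2/9 * (2/3) ^ m \<Longrightarrow> f t = t"
    and "\<And>t. 1 - 2/9 * (2/3) ^ n \<le> t \<Longrightarrow> t \<le> 1 \<Longrightarrow> f t = t"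
  shows "f \<in> lr_group"
  using assms
proof (induction m arbitrary: f)
  case 0
  show ?case
    by (rule small_germ_right[of f n]) (use 0 in auto)
next
  case (Suc m)
  let ?f = "inv\<^bsub>F_3_2\<^esub> l_map \<otimes>\<^bsub>F_3_2\<^esub> f \<otimes>\<^bsub>F_3_2\<^esub> l_map"
  note * = conj_fix[OF Suc.prems(1) l_map_in_F]
  have pow: "(2/3 :: real) ^ m \<le> 1" "(2/3 :: real) ^ n \<le> 1" by (simp_all add: power_le_one)
  have "?f \<in> lr_group"
  proof (rule Suc.IH)
    show "?f \<in> carrier F_3_2" using l_map_in_F Suc.prems(1) by simp
    show "?f t = t" if t: "0 \<le> t" "t \<le> 2/9 * (2/3) ^ m" for t
    proof -
      have t29: "t \<le> 2/9" using t pow(1) by linarith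
      then have "l_map (2/3 * t) = t" using t by (simp add: l_map_def)
      moreover have "f (2/3 * t) = 2/3 * t" using t by (intro Suc.prems(2)) auto
      ultimately show ?thesis using *[of "2/3 * t"] t t29 by simp
    qed
    show "?f t = t" if t: "1 - 2/9 * (2/3) ^ n \<le> t" "t \<le> 1" for t
    proof -
      have "7/9 \<le> t" using t pow(2) by linarith
      then have "l_map t = t" using t by (simp add: l_map_def)
      then show ?thesis using *[of t] t \<open>7/9 \<le> t\<close> Suc.prems(3)[of t] by simp
    qed
  qed
  then show ?case
    using lr_group_conj[OF Suc.prems(1) l_in_lr_group] by blast
qed

text \<open>The logarithmic slope at an end of the interval. The map \<open>e\<close> parametrizes the interval starting
  from this end, so that both ends are covered by one set of lemmas.\<close>

definition germ :: "(real \<Rightarrow> real) \<Rightarrow> (real \<Rightarrow> real) \<Rightarrow> int \<Rightarrow> bool" where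
  "germ e f k \<longleftrightarrow> (\<exists>\<epsilon>>0. \<epsilon> \<le> 1 \<and> (\<forall>t. 0 \<le> t \<and> t \<le> \<epsilon> \<longrightarrow> f (e t) = e ((3/2) powi k * t)))"

lemma germ_mult:
  assumes "germ e f k" "germ e g j" and e: "e ` {0..1} \<subseteq> {0..1}"
  shows "germ e (f \<otimes>\<^bsub>F_3_2\<^esub> g) (k + j)"
proof -
  obtain \<delta> where \<delta>: "0 < \<delta>" "\<delta> \<le> 1" "\<And>t. 0 \<le> t \<Longrightarrow> t \<le> \<delta> \<Longrightarrow> f (e t) = e ((3/2) powi k * t)"
    using assms(1) unfolding germ_def by blast
  obtain \<epsilon> where \<epsilon>: "0 < \<epsilon>" "\<epsilon> \<le> 1" "\<And>t. 0 \<le> t \<Longrightarrow> t \<le> \<epsilon> \<Longrightarrow> g (e t) = e ((3/2) powi j * t)"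
    using assms(2) unfolding germ_def by blast
  define c :: real where "c = (3/2) powi k"
  have c: "0 < c" by (simp add: c_def)
  have "(f \<otimes>\<^bsub>F_3_2\<^esub> g) (e t) = e ((3/2) powi (k + j) * t)" if t: "0 \<le> t" "t \<le> min \<delta> (\<epsilon> / c)" for t
  proof -
    have "t \<in> {0..1}" using t \<delta>(2) by auto
    then have "e t \<in> {0..1}" using e by blast
    moreover have "c * t \<le> \<epsilon>" using t c by (simp add: pos_le_divide_eq mult.commute)
    ultimately show ?thesis
      using \<delta>(3)[of t] \<epsilon>(3)[of "c * t"] t c
      by (simp add: F_mult c_def power_int_add mult_ac del: atLeastAtMost_iff)
  qed
  then show ?thesis
    unfolding germ_def using \<delta> \<epsilon> c by (intro exI[of _ "min \<delta> (\<epsilon> / c)"]) auto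
qed

lemma germ_inv:
  assumes "germ e g k" "g \<in> carrier F_3_2" and e: "e ` {0..1} \<subseteq> {0..1}"
  shows "germ e (inv\<^bsub>F_3_2\<^esub> g) (- k)"
proof -
  obtain \<delta> where \<delta>: "0 < \<delta>" "\<delta> \<le> 1" "\<And>t. 0 \<le> t \<Longrightarrow> t \<le> \<delta> \<Longrightarrow> g (e t) = e ((3/2) powi k * t)"
    using assms(1) unfolding germ_def by blast
  define c :: real where "c = (3/2) powi k"
  have c: "0 < c" by (simp add: c_def)
  have "(inv\<^bsub>F_3_2\<^esub> g) (e t) = e ((3/2) powi (- k) * t)" if t: "0 \<le> t" "t \<le> min 1 (c * \<delta>)" for t
  proof -
    have s: "0 \<le> t / c" "t / c \<le> \<delta>" using t c by (simp_all add: pos_divide_le_eq mult.commute)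
    then have "t / c \<in> {0..1}" using \<delta>(2) by auto
    then have "e (t / c) \<in> {0..1}" using e by blast
    then have "(inv\<^bsub>F_3_2\<^esub> g) (g (e (t / c))) = e (t / c)" by (rule F_inv[OF assms(2)])
    moreover have "g (e (t / c)) = e t" using \<delta>(3)[OF s] c by (simp add: c_def)
    ultimately show ?thesis by (simp add: c_def power_int_minus field_simps)
  qed
  then show ?thesis
    unfolding germ_def using \<delta> c by (intro exI[of _ "min 1 (c * \<delta>)"]) auto
qed

lemma germ_one: "e ` {0..1} \<subseteq> {0..1} \<Longrightarrow> germ e \<one>\<^bsub>F_3_2\<^esub> 0"
  unfolding germ_def by (intro exI[of _ 1]) (auto simp: F_one image_subset_iff)

lemma germ_int_pow:
  fixes n :: int
  assumes "germ e g k" "g \<in> carrier F_3_2" and e: "e ` {0..1} \<subseteq> {0..1}"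
  shows "germ e (g [^]\<^bsub>F_3_2\<^esub> n) (n * k)"
proof -
  have nat: "germ e (g [^]\<^bsub>F_3_2\<^esub> m) (int m * k)" for m :: nat
  proof (induction m)
    case 0
    show ?case using germ_one[OF e] by simp
  next
    case (Suc m)
    then show ?case using germ_mult[OF Suc assms(1) e] by (simp add: algebra_simps)
  qed
  show ?thesis
  proof (cases n)
    case (nonneg m)
    then show ?thesis using nat[of m] by (simp add: int_pow_int)
  next
    case (neg m)
    have "germ e (inv\<^bsub>F_3_2\<^esub> (g [^]\<^bsub>F_3_2\<^esub> Suc m)) (- (int (Suc m) * k))"
      using nat[of "Suc m"] assms(2) e by (intro germ_inv) auto
    then show ?thesis unfolding neg int_pow_neg[OF assms(2)] int_pow_int by (simp add: algebra_simps)
  qed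
qed

lemma finite_gap_right:
  fixes S :: "real set"
  assumes "finite S"
  shows "\<exists>q>0. q \<le> 1 \<and> {0<..<q} \<inter> S = {}"
proof -
  let ?T = "insert 1 (S \<inter> {0<..})"
  have fin: "finite ?T" using assms by simp
  have "Min ?T \<in> ?T" by (rule Min_in[OF fin]) simp
  moreover have "Min ?T \<le> 1" using fin by simp
  moreover have "{0<..<Min ?T} \<inter> S = {}" using Min_le[OF fin] by force
  ultimately show ?thesis by (intro exI[of _ "Min ?T"]) auto
qed

lemma germ_exists:
  assumes f: "f \<in> carrier F_3_2"
  shows "\<exists>k. germ (\<lambda>t. t) f k" "\<exists>k. germ (\<lambda>t. 1 - t) f k"
proof -
  obtain S where S: "breaks_in f S" using F_breaks[OF f] by blast
  then have fin: "finite S" by (simp add: breaks_in_def)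
  obtain q where q: "0 < q" "q \<le> 1" "{0<..<q} \<inter> S = {}"
    using finite_gap_right[OF fin] by blast
  then obtain k where k: "affine_piece f 0 q k"
    using S unfolding breaks_in_def by (metis order_refl)
  have "f t = (3/2) powi k * t" if "0 \<le> t" "t \<le> q" for t
    using affine_pieceD[OF k that] F_0[OF f] by simp
  then have "germ (\<lambda>t. t) f k" unfolding germ_def using q by blast
  then show "\<exists>k. germ (\<lambda>t. t) f k" by blast
  obtain p where p: "0 < p" "p \<le> 1" "{0<..<p} \<inter> (\<lambda>t. 1 - t) ` S = {}"
    using finite_gap_right[of "(\<lambda>t. 1 - t) ` S"] fin by blast
  have "{1 - p<..<1} \<inter> S = {}"
  proof (rule ccontr)
    assume "{1 - p<..<1} \<inter> S \<noteq> {}"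
    then obtain y where "1 - p < y" "y < 1" "y \<in> S" by auto
    then have "1 - y \<in> {0<..<p} \<inter> (\<lambda>t. 1 - t) ` S" by auto
    then show False using p by blast
  qed
  then obtain j where j: "affine_piece f (1 - p) 1 j"
    using S p unfolding breaks_in_def by (metis diff_ge_0_iff_ge diff_less_eq less_add_same_cancel1 order_refl)
  have end1: "f 1 = f (1 - p) + (3/2) powi j * p"
    using affine_pieceD[OF j, of 1] p by simp
  have "f (1 - t) = 1 - (3/2) powi j * t" if "0 \<le> t" "t \<le> p" for t
    using affine_pieceD[OF j, of "1 - t"] end1 F_1[OF f] that by (simp add: algebra_simps)
  then have "germ (\<lambda>t. 1 - t) f j" unfolding germ_def using p by blast
  then show "\<exists>k. germ (\<lambda>t. 1 - t) f k" by blast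
qed

lemma trivial_germs_in_lr_group:
  assumes f: "f \<in> carrier F_3_2" and "germ (\<lambda>t. t) f 0" "germ (\<lambda>t. 1 - t) f 0"
  shows "f \<in> lr_group"
proof -
  obtain \<delta> where \<delta>: "0 < \<delta>" "\<And>t. 0 \<le> t \<Longrightarrow> t \<le> \<delta> \<Longrightarrow> f t = t"
    using assms(2) unfolding germ_def by auto
  obtain \<epsilon> where \<epsilon>: "0 < \<epsilon>" "\<And>t. 0 \<le> t \<Longrightarrow> t \<le> \<epsilon> \<Longrightarrow> f (1 - t) = 1 - t"
    using assms(3) unfolding germ_def by auto
  obtain m where m: "(2/3 :: real) ^ m < \<delta>" using real_arch_pow_inv[of \<delta> "2/3"] \<delta> by auto
  obtain n where n: "(2/3 :: real) ^ n < \<epsilon>" using real_arch_pow_inv[of \<epsilon> "2/3"] \<epsilon> by auto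
  have pos: "0 \<le> (2/3 :: real) ^ m" "0 \<le> (2/3 :: real) ^ n" by simp_all
  show ?thesis
  proof (rule small_germs[OF f, of m n])
    show "f t = t" if "0 \<le> t" "t \<le> 2/9 * (2/3) ^ m" for t
      using \<delta>(2)[of t] that m pos by linarith
    show "f t = t" if "1 - 2/9 * (2/3) ^ n \<le> t" "t \<le> 1" for t
    proof -
      have "1 - t \<le> \<epsilon>" using that n pos by linarith
      then show ?thesis using \<epsilon>(2)[of "1 - t"] that by simp
    qed
  qed
qed

lemma carrier_in_lr_group:
  assumes f: "f \<in> carrier F_3_2"
  shows "f \<in> lr_group"
proof -
  have e: "(\<lambda>t. t) ` {0..1} \<subseteq> {0..1::real}" "(\<lambda>t. 1 - t) ` {0..1} \<subseteq> {0..1::real}" by auto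
  have l: "germ (\<lambda>t. t) l_map 1" "germ (\<lambda>t. 1 - t) l_map 0"
    unfolding germ_def l_map_def by (rule exI[of _ "2/9"], simp)+
  have r: "germ (\<lambda>t. t) r_map 0" "germ (\<lambda>t. 1 - t) r_map (- 1)"
    unfolding germ_def r_map_def by (rule exI[of _ "2/9"], simp add: power_int_minus field_simps)+
  obtain k j where kj: "germ (\<lambda>t. t) f k" "germ (\<lambda>t. 1 - t) f j" using germ_exists[OF f] by blast
  let ?l = "l_map [^]\<^bsub>F_3_2\<^esub> (- k)" and ?r = "r_map [^]\<^bsub>F_3_2\<^esub> j"
  have in_lr: "?l \<in> lr_group" "?r \<in> lr_group"
    using subgroup_int_pow_closed[OF lr_group_subgroup] l_in_lr_group r_in_lr_group by blast+
  have "germ (\<lambda>t. t) (f \<otimes>\<^bsub>F_3_2\<^esub> ?l \<otimes>\<^bsub>F_3_2\<^esub> ?r) (k + - k * 1 + j * 0)"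
    by (intro germ_mult germ_int_pow kj l r l_map_in_F r_map_in_F e)
  moreover have "germ (\<lambda>t. 1 - t) (f \<otimes>\<^bsub>F_3_2\<^esub> ?l \<otimes>\<^bsub>F_3_2\<^esub> ?r) (j + - k * 0 + j * (- 1))"
    by (intro germ_mult germ_int_pow kj l r l_map_in_F r_map_in_F e)
  ultimately have "f \<otimes>\<^bsub>F_3_2\<^esub> ?l \<otimes>\<^bsub>F_3_2\<^esub> ?r \<in> lr_group"
    using f l_map_in_F r_map_in_F by (intro trivial_germs_in_lr_group) simp_all
  then have "f \<otimes>\<^bsub>F_3_2\<^esub> ?l \<in> lr_group"
    using f l_map_in_F in_lr(2) by (intro lr_group_cancel[of "f \<otimes>\<^bsub>F_3_2\<^esub> ?l" ?r]) simp_all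
  then show ?thesis
    using lr_group_cancel[OF f in_lr(1)] by blast
qed

end

theorem theorem2:
  "group F_3_2 \<and> l_map \<in> carrier F_3_2 \<and> r_map \<in> carrier F_3_2 \<and>
   generate F_3_2 {l_map, r_map} = carrier F_3_2"
  using group_F_3_2 l_map_in_F r_map_in_F carrier_in_lr_group lr_group_sub by blast

end
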